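(* Assume that $g$ is convex, that $\beta_1,\dots,\beta_L>0$ satisfy $$\beta_\ell > (K_g+1)\prod_{j=\ell+1}^{L}(1+K_{j-1})\quad\text{for all }\ell\in[L],$$ where $K_g>0$ and $K_1,\dots,K_{L-1}>0$ are constants such that, for every $z=(\theta,u)\in \mathrm{lev}_{\le\Theta(z^0)}\Theta$ and all $d,\bar d\in\mathbb{R}^{\bar N}$ with $d_\theta=\bar d_\theta$, $$|g'(u;d_u)-g'(u;\bar d_u)|\le K_g\|d_u-\bar d_u\|,$$ $$\|\psi_{\ell-1}'(\theta,\mathbf{u}_{\ell-1};d_\theta,d_{\mathbf{u}_{\ell-1}})-\psi_{\ell-1}'(\theta,\mathbf{u}_{\ell-1};\bar d_\theta,\bar d_{\mathbf{u}_{\ell-1}})\|\le K_{\ell-1}\|d_{\mathbf{u}_{\ell-1}}-\bar d_{\mathbf{u}_{\ell-1}}\|,\quad \ell=2,\dots,L,$$ and that the initial point satisfies $z^1\in\mathrm{lev}_{\le\Theta(z^0)}\Theta$. Let $\{z^k\}$ be generated by the SRPA algorithm. Then for every $\epsilon\in(0,1)$ there exists $k\le\bar k(\epsilon)$, where $$\bar k(\epsilon)=\left\lceil \kappa_1+6\gamma^2\eta_1^{-1}\rho_1^{-1}\big(\Theta(z^1)-\Theta^*\big)\epsilon^{-2}\right\rceil,$$ such that $z^k$ is an $\epsilon$-approximate second-order d-stationary point of the problem $\min_z\Theta(z)$. Here $$\kappa_1=\left[\left\lceil\log_{\eta_2}\!\left(\frac{\bar K_F+\sqrt J\,\bar K_c}{\rho_1(1-\eta_1)}\right)\right\rceil\right]_+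 +1,$$ $$\gamma=\max\left\{\frac{2(\Theta(z^1)-\Theta^* )}{\big(\sqrt{2\rho_1^{-1}\Theta(z^1)}+2\rho_1^{-1}K_F\big)^2},\ \frac{8(\Theta(z^1)-\Theta^* )}{\delta^2},\ \rho_1\eta_2+2(\bar K_F+\sqrt J\bar K_c),\ \Big(\frac{\eta_2^2}{1-\eta_1}+2\Big)(\bar K_F+\sqrt J\bar K_c),\ 1\right\}.$$
   Context: Setting. Let $L,n,N_1,\dots,N_L$ be positive integers, $[L]=\{1,\dots,L\}$, $\bar N_0=0$, $\bar N_\ell=\sum_{j=1}^{\ell}N_j$, $\bar N=n+\bar N_L$. Write $z=(\theta^\top,u_1^\top,\dots,u_L^\top)^\top\in\mathbb{R}^{\bar N}$, $\theta\in\mathbb{R}^n$, $u_\ell\in\mathbb{R}^{N_\ell}$; $\mathbf{u}_\ell=(u_1^\top,\dots,u_\ell^\top)^\top$, $u=\mathbf u_L$, $\mathbf u_0$ empty. A direction $d\in\mathbb{R}^{\bar N}$ is split in the same way into $d_\theta,d_{u_1},\dots,d_{u_L}$, with $d_{\mathbf u_\ell}$ and $d_u$ defined analogously. Let $g:\mathbb{R}^{\bar N_L}\to\mathbb{R}_+$ and $\psi_{\ell-1}:\mathbb{R}^{n+\bar N_{\ell-1}}\to\mathbb{R}^{N_\ell}$ be locally Lipschitz and twice directionally differentiable (i.e. the limits $f'(x;d)=\lim_{\tau\downarrow0}\frac{f(x+\tau d)-f(x)}{\tau}$ and $f^{(2)}(x;d)=\lim_{\tau\downarrow0}\frac{f(x+\tau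 d)-f(x)-\tau f'(x;d)}{\tau^2/2}$, componentwise for vector-valued functions, exist for all $x,d$), $\lambda>0$, $\beta_\ell>0$, and $$F(z)=g(u)+\lambda\|\theta\|^2,\quad \Theta(z)=F(z)+\sum_{\ell=1}^L\beta_\ell\|u_\ell-\psi_{\ell-1}(\theta,u_1,\dots,u_{\ell-1})\|_1 .$$ Then $\Theta$ is twice directionally differentiable. The point $z^0=(\mathbf 0,(u_1^0)^\top,\dots,(u_L^0)^\top)^\top$ is defined recursively by $u_\ell^0=\psi_{\ell-1}(\mathbf 0,u_1^0,\dots,u_{\ell-1}^0)$, $\ell\in[L]$. "Smooth" means differentiable with locally Lipschitz gradient. A function is piecewise affine if its domain is a finite union of polyhedral sets on each of which it is affine. Assume moreover that $g$ is smooth and every component of every $\psi_{\ell-1}$ is either smooth or piecewise affine. Then $\Theta$ is written as $\Theta(z)=F(z)+H(z)+\sum_{j\in\mathcal J}|c_j(z)|$ with $H:\mathbb{R}^{\bar N}\to\mathbb{R}_+$ continuous piecewise affine, $c_j:\mathbb{R}^{\bar N}\to\mathbb{R}$ smooth, $\mathcal J=\{1,\dots,J\}$, $0\le J\le\bar N_L$ (components with piecewise affine $\psi$ are collected in $H$, the others in the $c_j$); fix this decomposition, and set $c=(c_1,\dots,c_J)^\top$, $\nabla c$ = transposed Jacobian. Fix finitely many nonempty, mutually distinct polyhedra $P_1,\dots,P_I$ with $\bigcup_{i\in[I]}P_i=\mathbb{R}^{\bar N}$ such that $H$ is affine on each $P_i$. The function $\Theta$ is level-bounded and $\Theta^*=\min_z\Theta(z)$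 is finite. Notation: $\|\cdot\|$ Euclidean (spectral for matrices) norm; empty products equal $1$; $\mathbf d(z,P)=\inf_{y\in P}\|z-y\|$; $\mathbb B(z;r)$ closed ball; $[a]_+=\max\{a,0\}$; $\mathrm{lev}_{\le\gamma}\Theta=\{z:\Theta(z)\le\gamma\}$; $\mathcal A^\delta(z)=\{i\in[I]:\mathbf d(z,P_i)\le\delta\}$. SRPA algorithm. Input: $z^1\in\mathbb{R}^{\bar N}$, $\rho_1>0$, $\eta_1\in(0,1)$, $\eta_2>1$, $\delta>0$. For $k=1,2,\dots$: with $$\Phi_k(s)=F(z^k)+\nabla F(z^k)^\top s+H(z^k+s)+\sum_{j\in\mathcal J}|c_j(z^k)+\nabla c_j(z^k)^\top s|+\frac{\rho_k}{2}\|s\|^2,$$ for each $i\in\mathcal A^\delta(z^k)$ let $s^{k,i}$ be the minimizer of $\Phi_k$ over $\{z-z^k:z\in P_i\}$; let $s^k$ be one of the $s^{k,i}$, $i\in\mathcal A^\delta(z^k)$, with the smallest value of $\Phi_k$. If $\Phi_k(s^k)=\Phi_k(\mathbf 0)$, terminate and output $z^k$. Otherwise, set $(z^{k+1},\rho_{k+1})=(z^k+s^k,\rho_k)$ if $\Theta(z^k)-\Theta(z^k+s^k)\ge\frac{\eta_1\rho_k}{2}\|s^k\|^2$, and $(z^{k+1},\rho_{k+1})=(z^k,\eta_2\rho_k)$ otherwise. Constants: $K_F>0$ satisfies $\|\nabla F(z)\|\le K_F$ for all $z\in\mathrm{lev}_{\le\Theta(z^1)}\Theta$; $\bar K_F,\bar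 K_c>0$ satisfy $\|\nabla F(z)-\nabla F(y)\|\le\bar K_F\|z-y\|$ and $\|\nabla c(z)-\nabla c(y)\|\le\bar K_c\|z-y\|$ for all $z,y\in\mathrm{lev}_{\le\Theta(z^1)}\Theta+\mathbb B\big(\mathbf 0;2\rho_1^{-1}K_F+\sqrt{2\rho_1^{-1}\Theta(z^1)}\big)$. Definition: $z$ is an $\epsilon$-approximate second-order d-stationary point if there is $y\in\mathbb B(z;\epsilon)$ with $\Theta'(y;d)\ge-\epsilon$ for all $d$ with $\|d\|=1$, and $\Theta^{(2)}(y;d)\ge-\epsilon$ for all $d$ with $\|d\|=1$ and $\Theta'(y;d)=-\epsilon$. *)

theory Defs
  imports "HOL-Analysis.Analysis"
begin

text \<open>
  The variable $z = (\theta, u)$ lives in \<open>(real^'n) \<times> (real^'m)\<close>, whose norm and inner product are the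
  Euclidean ones. The index type \<open>'m\<close> of $u = (u_1,\dots,u_L)$ is partitioned into layers by a map
  \<open>blk :: 'm \<Rightarrow> nat\<close> with range \<open>{1..L}\<close>, so $N_\ell$ is the cardinality of \<open>{i. blk i = l}\<close>.
  Elements of $R^{N_\ell}$ and of $R^{N_1+\dots+N_\ell}$ are identified with the elements of
  \<open>real^'m\<close> that vanish off the coordinates in question (an isometric linear embedding).
\<close>

definition block :: "('m::finite \<Rightarrow> nat) \<Rightarrow> nat \<Rightarrow> real^'m \<Rightarrow> real^'m" where
  "block blk l u = (\<chi> i. if blk i = l then u $ i else 0)"

text \<open>The vector $(u_1,\dots,u_l)$; it is zero for \<open>l = 0\<close>.\<close>

definition upto_block :: "('m::finite \<Rightarrow> nat) \<Rightarrow> nat \<Rightarrow> real^'m \<Rightarrow> real^'m" where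
  "upto_block blk l u = (\<chi> i. if blk i \<in> {1..l} then u $ i else 0)"

text \<open>
  A map $\psi_{l-1}$ from $R^{n+N_1+\dots+N_{l-1}}$ to $R^{N_l}$, extended to all of
  \<open>(real^'n) \<times> (real^'m)\<close> so as not to depend on the coordinates of layers \<open>\<ge> l\<close>. Local Lipschitz
  continuity, directional differentiability, smoothness and piecewise affinity of the original map
  and of this extension are the same.
\<close>

definition layer_map ::
    "('m::finite \<Rightarrow> nat) \<Rightarrow> nat \<Rightarrow> ((real^'n) \<times> (real^'m) \<Rightarrow> real^'m) \<Rightarrow> bool" where
  "layer_map blk l f \<longleftrightarrow>
     (\<forall>\<theta> u. f (\<theta>, u) = f (\<theta>, upto_block blk (l - 1) u)) \<and>
     (\<forall>x. block blk l (f x) = f x)"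

definition l1_norm :: "real^'m \<Rightarrow> real" where
  "l1_norm x = (\<Sum>i\<in>UNIV. \<bar>x $ i\<bar>)"

definition dir_deriv :: "('a::real_normed_vector \<Rightarrow> 'b::real_normed_vector) \<Rightarrow> 'a \<Rightarrow> 'a \<Rightarrow> 'b" where
  "dir_deriv f x d = Lim (at_right 0) (\<lambda>t. (f (x + t *\<^sub>R d) - f x) /\<^sub>R t)"

definition dir_deriv2 :: "('a::real_normed_vector \<Rightarrow> 'b::real_normed_vector) \<Rightarrow> 'a \<Rightarrow> 'a \<Rightarrow> 'b" where
  "dir_deriv2 f x d =
     Lim (at_right 0) (\<lambda>t. (f (x + t *\<^sub>R d) - f x - t *\<^sub>R dir_deriv f x d) /\<^sub>R (t\<^sup>2 / 2))"

definition twice_dir_differentiable ::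
    "('a::real_normed_vector \<Rightarrow> 'b::real_normed_vector) \<Rightarrow> bool" where
  "twice_dir_differentiable f \<longleftrightarrow> (\<forall>x d.
     (\<exists>l. ((\<lambda>t. (f (x + t *\<^sub>R d) - f x) /\<^sub>R t) \<longlongrightarrow> l) (at_right 0)) \<and>
     (\<exists>l. ((\<lambda>t. (f (x + t *\<^sub>R d) - f x - t *\<^sub>R dir_deriv f x d) /\<^sub>R (t\<^sup>2 / 2)) \<longlongrightarrow> l)
        (at_right 0)))"

definition locally_lipschitz :: "('a::metric_space \<Rightarrow> 'b::metric_space) \<Rightarrow> bool" where
  "locally_lipschitz f \<longleftrightarrow> (\<forall>x. \<exists>r>0. \<exists>C. C-lipschitz_on (ball x r) f)"

definition gradient :: "('a::real_inner \<Rightarrow> real) \<Rightarrow> 'a \<Rightarrow> 'a" where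
  "gradient f x = (THE D. GDERIV f x :> D)"

definition smooth :: "('a::euclidean_space \<Rightarrow> real) \<Rightarrow> bool" where
  "smooth f \<longleftrightarrow> (\<forall>x. f differentiable (at x)) \<and> locally_lipschitz (gradient f)"

definition affine_fun_on :: "'a::euclidean_space set \<Rightarrow> ('a \<Rightarrow> real) \<Rightarrow> bool" where
  "affine_fun_on S f \<longleftrightarrow> (\<exists>a b. \<forall>x\<in>S. f x = a \<bullet> x + b)"

definition piecewise_affine :: "('a::euclidean_space \<Rightarrow> real) \<Rightarrow> bool" where
  "piecewise_affine f \<longleftrightarrow>
     (\<exists>\<P>. finite \<P> \<and> \<Union>\<P> = UNIV \<and> (\<forall>P\<in>\<P>. polyhedron P \<and> affine_fun_on P f))"

definition lev :: "('a \<Rightarrow> real) \<Rightarrow> real \<Rightarrow> 'a set" where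
  "lev f a = {z. f z \<le> a}"

definition level_bounded :: "('a::metric_space \<Rightarrow> real) \<Rightarrow> bool" where
  "level_bounded f \<longleftrightarrow> (\<forall>a. bounded (lev f a))"

definition objective ::
    "(real^'m \<Rightarrow> real) \<Rightarrow> real \<Rightarrow> (real^'n) \<times> (real^'m) \<Rightarrow> real" where
  "objective g lam z = g (snd z) + lam * (norm (fst z))\<^sup>2"

definition penalized ::
    "('m::finite \<Rightarrow> nat) \<Rightarrow> nat \<Rightarrow> (nat \<Rightarrow> real) \<Rightarrow> (nat \<Rightarrow> (real^'n) \<times> (real^'m) \<Rightarrow> real^'m)
     \<Rightarrow> (real^'m \<Rightarrow> real) \<Rightarrow> real \<Rightarrow> (real^'n) \<times> (real^'m) \<Rightarrow> real" where
  "penalized blk L \<beta> \<psi> g lam z = objective g lam z +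
     (\<Sum>l=1..L. \<beta> l *
        l1_norm (block blk l (snd z) - \<psi> (l - 1) (fst z, upto_block blk (l - 1) (snd z))))"

text \<open>
  The decomposition $\Theta = F + H + \sum_{j=1}^J |c_j|$: the penalty terms of the components
  enumerated by \<open>\<sigma>\<close> become the $|c_j|$ (the sign of $c_j$ is left free), and those of the remaining
  components, for which $\psi$ is piecewise affine, are collected in $H$.
\<close>

definition penalty_decomposition ::
    "('m::finite \<Rightarrow> nat) \<Rightarrow> (nat \<Rightarrow> real) \<Rightarrow> (nat \<Rightarrow> (real^'n) \<times> (real^'m) \<Rightarrow> real^'m)
     \<Rightarrow> ((real^'n) \<times> (real^'m) \<Rightarrow> real) \<Rightarrow> ((real^'n) \<times> (real^'m) \<Rightarrow> real)
     \<Rightarrow> ((real^'n) \<times> (real^'m) \<Rightarrow> real) \<Rightarrow> (nat \<Rightarrow> (real^'n) \<times> (real^'m) \<Rightarrow> real) \<Rightarrow> nat \<Rightarrow> bool" where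
  "penalty_decomposition blk \<beta> \<psi> \<Theta> F H c J \<longleftrightarrow>
     J \<le> CARD('m) \<and>
     (\<forall>z. \<Theta> z = F z + H z + (\<Sum>j=1..J. \<bar>c j z\<bar>)) \<and>
     (\<forall>z. 0 \<le> H z) \<and> continuous_on UNIV H \<and> piecewise_affine H \<and>
     (\<forall>j\<in>{1..J}. smooth (c j)) \<and>
     (let r = (\<lambda>i z. \<beta> (blk i) *
                \<bar>snd z $ i - \<psi> (blk i - 1) (fst z, upto_block blk (blk i - 1) (snd z)) $ i\<bar>)
      in \<exists>\<sigma>. inj_on \<sigma> {1..J} \<and>
           (\<forall>j\<in>{1..J}. \<forall>z. \<bar>c j z\<bar> = r (\<sigma> j) z) \<and>
           (\<forall>i\<in>- \<sigma> ` {1..J}. piecewise_affine (\<lambda>x. \<psi> (blk i - 1) x $ i)) \<and>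
           (\<forall>z. H z = (\<Sum>i\<in>- \<sigma> ` {1..J}. r i z)))"

text \<open>
  The spectral norm of the matrix with columns \<open>v 1, \<dots>, v J\<close>, as the operator norm with respect to
  the Euclidean norms of the map it induces on $R^J$ (zero for \<open>J = 0\<close>).
\<close>

definition spectral_norm :: "nat \<Rightarrow> (nat \<Rightarrow> 'a::real_normed_vector) \<Rightarrow> real" where
  "spectral_norm J v = Sup {norm (\<Sum>j=1..J. w j *\<^sub>R v j) | w. L2_set w {1..J} \<le> 1}"

definition active :: "nat \<Rightarrow> (nat \<Rightarrow> 'a::metric_space set) \<Rightarrow> real \<Rightarrow> 'a \<Rightarrow> nat set" where
  "active m P \<delta> z = {i\<in>{1..m}. infdist z (P i) \<le> \<delta>}"

definition model ::
    "('a::euclidean_space \<Rightarrow> real) \<Rightarrow> ('a \<Rightarrow> real) \<Rightarrow> (nat \<Rightarrow> 'a \<Rightarrow> real) \<Rightarrow> nat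
     \<Rightarrow> 'a \<Rightarrow> real \<Rightarrow> 'a \<Rightarrow> real" where
  "model F H c J z \<rho> s = F z + gradient F z \<bullet> s + H (z + s) +
     (\<Sum>j=1..J. \<bar>c j z + gradient (c j) z \<bullet> s\<bar>) + \<rho> / 2 * (norm s)\<^sup>2"

text \<open>
  Runs of the algorithm. The iterations are those \<open>k \<ge> 1\<close> with \<open>enat k \<le> T\<close>: the run stops and
  outputs \<open>z T\<close> at a finite \<open>T\<close>, and never stops if \<open>T = \<infinity>\<close>. Values of \<open>z\<close>, \<open>\<rho>\<close>, \<open>s\<close> outside this
  range are irrelevant. The input is \<open>z 1\<close>, \<open>\<rho> 1\<close>, \<open>\<eta>1\<close>, \<open>\<eta>2\<close>, \<open>\<delta>\<close>.
\<close>

definition srpa_run ::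
    "('a::euclidean_space \<Rightarrow> real) \<Rightarrow> ('a \<Rightarrow> real) \<Rightarrow> ('a \<Rightarrow> real) \<Rightarrow> (nat \<Rightarrow> 'a \<Rightarrow> real) \<Rightarrow> nat
     \<Rightarrow> nat \<Rightarrow> (nat \<Rightarrow> 'a set) \<Rightarrow> real \<Rightarrow> real \<Rightarrow> real
     \<Rightarrow> (nat \<Rightarrow> 'a) \<Rightarrow> (nat \<Rightarrow> real) \<Rightarrow> (nat \<Rightarrow> 'a) \<Rightarrow> enat \<Rightarrow> bool" where
  "srpa_run \<Theta> F H c J m P \<eta>1 \<eta>2 \<delta> z \<rho> s T \<longleftrightarrow> 1 \<le> T \<and>
     (\<forall>k\<ge>1. enat k \<le> T \<longrightarrow>
        (let \<Phi> = model F H c J (z k) (\<rho> k); A = active m P \<delta> (z k) in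
           (\<exists>t. (\<forall>i\<in>A. is_arg_min \<Phi> (\<lambda>v. v \<in> (\<lambda>x. x - z k) ` P i) (t i)) \<and>
                is_arg_min \<Phi> (\<lambda>v. v \<in> t ` A) (s k)) \<and>
           (enat k = T \<longleftrightarrow> \<Phi> (s k) = \<Phi> 0) \<and>
           (enat k < T \<longrightarrow>
              (z (k + 1), \<rho> (k + 1)) =
                (if \<Theta> (z k) - \<Theta> (z k + s k) \<ge> \<eta>1 * \<rho> k / 2 * (norm (s k))\<^sup>2
                 then (z k + s k, \<rho> k) else (z k, \<eta>2 * \<rho> k)))))"

definition approx_second_order_d_stationary ::
    "('a::real_normed_vector \<Rightarrow> real) \<Rightarrow> real \<Rightarrow> 'a \<Rightarrow> bool" where
  "approx_second_order_d_stationary \<Theta> \<epsilon> z \<longleftrightarrow>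
     (\<exists>y\<in>cball z \<epsilon>.
        (\<forall>d. norm d = 1 \<longrightarrow> dir_deriv \<Theta> y d \<ge> - \<epsilon>) \<and>
        (\<forall>d. norm d = 1 \<and> dir_deriv \<Theta> y d = - \<epsilon> \<longrightarrow> dir_deriv2 \<Theta> y d \<ge> - \<epsilon>))"

end

theory Submission
  imports Defs
begin

text \<open>
  Let \<open>y\<close> be a global minimizer of $\Theta + \frac{\gamma}{2}\|\cdot - z^k\|^2$. The model $\Phi_k$ without
  its quadratic term differs from $\Theta(z^k + \cdot)$ by at most $\frac{1}{2}(\bar K_F + \sqrt{J} \bar K_c)\|\cdot\|^2$,
  and $s^k$ minimizes $\Phi_k$ on the ball of radius $\delta$, because the polyhedra active at $z^k$ cover this ball.
  Comparing both gives $\|y - z^k\|^2 \le 3\|s^k\|^2$. Rejected steps are few, because a large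
  $\rho_k$ forces acceptance, and accepted steps decrease $\Theta$ by a multiple of $\|s^k\|^2$; so some
  $s^k$ is short, and then $\Theta'(y;d) \ge -\epsilon\|d\|$ for all \<open>d\<close>.

  Given such a point \<open>y\<close>, the lower bounds on $\beta_\ell$ imply that \<open>y\<close> satisfies all the layer equations
  $u_\ell = \psi_{\ell-1}$, and that a unit vector \<open>d\<close> with $\Theta'(y;d) = -\epsilon$ satisfies their linearizations.
  Hence the penalty has zero first-order part along \<open>d\<close>, and $\Theta^{(2)}(y;d) \ge F^{(2)}(y;d) \ge 0$ by
  convexity of \<open>g\<close>.
\<close>

section \<open>Directional derivatives and gradients\<close>

text \<open>\<open>dir_deriv\<close> is a \<open>Lim\<close> and has a value even where no limit
  exists; this relation also carries existence, as the calculus rules below require.\<close>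

definition has_dir_deriv ::
    "('a::real_normed_vector \<Rightarrow> 'b::real_normed_vector) \<Rightarrow> 'a \<Rightarrow> 'a \<Rightarrow> 'b \<Rightarrow> bool" where
  "has_dir_deriv f x d l \<longleftrightarrow> ((\<lambda>t. (f (x + t *\<^sub>R d) - f x) /\<^sub>R t) \<longlongrightarrow> l) (at_right 0)"

lemma dir_deriv_eq: "has_dir_deriv f x d l \<Longrightarrow> dir_deriv f x d = l"
  unfolding has_dir_deriv_def dir_deriv_def by (intro tendsto_Lim) auto

lemma twice_dir_differentiableD:
  assumes "twice_dir_differentiable f"
  shows "has_dir_deriv f x d (dir_deriv f x d)"
  using assms dir_deriv_eq unfolding twice_dir_differentiable_def has_dir_deriv_def by metis

lemma dir_deriv2_tendsto:
  assumes "twice_dir_differentiable f"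
  shows "((\<lambda>t. (f (x + t *\<^sub>R d) - f x - t *\<^sub>R dir_deriv f x d) /\<^sub>R (t\<^sup>2 / 2)) \<longlongrightarrow> dir_deriv2 f x d)
    (at_right 0)"
proof -
  obtain l where l: "((\<lambda>t. (f (x + t *\<^sub>R d) - f x - t *\<^sub>R dir_deriv f x d) /\<^sub>R (t\<^sup>2 / 2)) \<longlongrightarrow> l)
    (at_right 0)"
    using assms unfolding twice_dir_differentiable_def by blast
  then have "dir_deriv2 f x d = l"
    unfolding dir_deriv2_def by (intro tendsto_Lim) auto
  with l show ?thesis by simp
qed

lemma has_dir_deriv_imp_tendsto:
  assumes "has_dir_deriv f x d l"
  shows "((\<lambda>t. f (x + t *\<^sub>R d)) \<longlongrightarrow> f x) (at_right 0)"
proof -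
  have "((\<lambda>t. f x + t *\<^sub>R ((f (x + t *\<^sub>R d) - f x) /\<^sub>R t)) \<longlongrightarrow> f x + 0 *\<^sub>R l) (at_right 0)"
    using assms unfolding has_dir_deriv_def by (intro tendsto_intros)
  moreover have "\<forall>\<^sub>F t in at_right 0. f x + t *\<^sub>R ((f (x + t *\<^sub>R d) - f x) /\<^sub>R t) = f (x + t *\<^sub>R d)"
    using eventually_at_right_less[of "0::real"] by eventually_elim simp
  ultimately show ?thesis
    by (auto intro: Lim_transform_eventually)
qed

lemma has_dir_deriv_add:
  assumes "has_dir_deriv f x d l" "has_dir_deriv g x d l'"
  shows "has_dir_deriv (\<lambda>x. f x + g x) x d (l + l')"
  using tendsto_add[OF assms[unfolded has_dir_deriv_def]]
  unfolding has_dir_deriv_def by (simp add: algebra_simps)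

lemma has_dir_deriv_diff:
  assumes "has_dir_deriv f x d l" "has_dir_deriv g x d l'"
  shows "has_dir_deriv (\<lambda>x. f x - g x) x d (l - l')"
  using tendsto_diff[OF assms[unfolded has_dir_deriv_def]]
  unfolding has_dir_deriv_def by (simp add: algebra_simps)

lemma has_dir_deriv_mult_const:
  fixes f :: "'a::real_normed_vector \<Rightarrow> real"
  assumes "has_dir_deriv f x d l"
  shows "has_dir_deriv (\<lambda>x. b * f x) x d (b * l)"
  using tendsto_mult[OF tendsto_const[of b] assms[unfolded has_dir_deriv_def]]
  unfolding has_dir_deriv_def by (simp add: algebra_simps)

lemma has_dir_deriv_sum:
  assumes "\<And>i. i \<in> I \<Longrightarrow> has_dir_deriv (f i) x d (l i)"
  shows "has_dir_deriv (\<lambda>x. \<Sum>i\<in>I. f i x) x d (\<Sum>i\<in>I. l i)"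
proof -
  have "((\<lambda>t. \<Sum>i\<in>I. (f i (x + t *\<^sub>R d) - f i x) /\<^sub>R t) \<longlongrightarrow> (\<Sum>i\<in>I. l i)) (at_right 0)"
    using assms unfolding has_dir_deriv_def by (intro tendsto_sum)
  then show ?thesis
    unfolding has_dir_deriv_def by (simp add: scaleR_sum_right[symmetric] sum_subtractf)
qed

lemma has_dir_deriv_bounded_linear:
  assumes "bounded_linear h"
  shows "has_dir_deriv h x d (h d)"
proof -
  interpret bounded_linear h by fact
  have "\<forall>\<^sub>F t in at_right 0. h d = (h (x + t *\<^sub>R d) - h x) /\<^sub>R t"
    using eventually_at_right_less[of "0::real"] by eventually_elim (simp add: add scaleR)
  then show ?thesis
    unfolding has_dir_deriv_def by (rule Lim_transform_eventually[OF tendsto_const])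
qed

lemma has_dir_deriv_vec_nth:
  assumes "has_dir_deriv f x d l"
  shows "has_dir_deriv (\<lambda>x. f x $ i) x d (l $ i)"
  using tendsto_vec_nth[OF assms[unfolded has_dir_deriv_def], of i]
  unfolding has_dir_deriv_def by simp

text \<open>At a zero of \<open>f\<close> the quotient of the absolute value is the absolute value
  of the quotient, as \<open>t > 0\<close>. Elsewhere \<open>f\<close> keeps its sign for small
  \<open>t\<close>, being continuous along the ray.\<close>

lemma has_dir_deriv_abs:
  fixes f :: "'a::real_normed_vector \<Rightarrow> real"
  assumes "has_dir_deriv f x d l"
  shows "has_dir_deriv (\<lambda>x. \<bar>f x\<bar>) x d (if f x = 0 then \<bar>l\<bar> else sgn (f x) * l)"
proof (cases "f x = 0")
  case True
  have "((\<lambda>t. \<bar>(f (x + t *\<^sub>R d) - f x) /\<^sub>R t\<bar>) \<longlongrightarrow> \<bar>l\<bar>) (at_right 0)"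
    using assms unfolding has_dir_deriv_def by (intro tendsto_rabs)
  moreover have "\<forall>\<^sub>F t in at_right 0.
      \<bar>(f (x + t *\<^sub>R d) - f x) /\<^sub>R t\<bar> = (\<bar>f (x + t *\<^sub>R d)\<bar> - \<bar>f x\<bar>) /\<^sub>R t"
    using eventually_at_right_less[of "0::real"]
    by eventually_elim (simp add: True abs_mult)
  ultimately show ?thesis
    using True unfolding has_dir_deriv_def by (auto intro: Lim_transform_eventually)
next
  case False
  have lim: "((\<lambda>t. sgn (f x) * f (x + t *\<^sub>R d)) \<longlongrightarrow> sgn (f x) * f x) (at_right 0)"
    by (intro tendsto_intros has_dir_deriv_imp_tendsto[OF assms])
  have "sgn (f x) * f x > 0"
    using False by (auto simp: sgn_if)
  then have "\<forall>\<^sub>F t in at_right 0. sgn (f x) * f (x + t *\<^sub>R d) > 0"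
    using order_tendstoD(1)[OF lim] by blast
  then have "\<forall>\<^sub>F t in at_right 0. sgn (f x) * ((f (x + t *\<^sub>R d) - f x) /\<^sub>R t)
      = (\<bar>f (x + t *\<^sub>R d)\<bar> - \<bar>f x\<bar>) /\<^sub>R t"
    by eventually_elim (use False in \<open>auto simp: sgn_if algebra_simps split: if_splits\<close>)
  moreover have "((\<lambda>t. sgn (f x) * ((f (x + t *\<^sub>R d) - f x) /\<^sub>R t)) \<longlongrightarrow> sgn (f x) * l) (at_right 0)"
    using assms unfolding has_dir_deriv_def by (intro tendsto_intros)
  ultimately show ?thesis
    using False unfolding has_dir_deriv_def by (auto intro: Lim_transform_eventually)
qed

text \<open>Difference quotients of a convex function increase with the step length, so their limit
  at 0 is at most the quotient at \<open>t\<close>.\<close>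

lemma convex_on_dir_deriv_le:
  fixes f :: "'a::real_normed_vector \<Rightarrow> real"
  assumes "convex_on UNIV f" "has_dir_deriv f x d l" "t > 0"
  shows "t * l \<le> f (x + t *\<^sub>R d) - f x"
proof -
  have "\<forall>\<^sub>F \<tau> in at_right 0. (f (x + \<tau> *\<^sub>R d) - f x) /\<^sub>R \<tau> \<le> (f (x + t *\<^sub>R d) - f x) / t"
    using eventually_at_right_real[OF assms(3)]
  proof eventually_elim
    case (elim \<tau>)
    have "f ((1 - \<tau> / t) *\<^sub>R x + (\<tau> / t) *\<^sub>R (x + t *\<^sub>R d)) \<le> (1 - \<tau> / t) * f x + (\<tau> / t) * f (x + t *\<^sub>R d)"
      using elim assms(3) by (intro convex_onD[OF assms(1)]) auto
    moreover have "(1 - \<tau> / t) *\<^sub>R x + (\<tau> / t) *\<^sub>R (x + t *\<^sub>R d) = x + \<tau> *\<^sub>R d"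
      using assms(3) by (simp add: algebra_simps)
    ultimately have "f (x + \<tau> *\<^sub>R d) \<le> (1 - \<tau> / t) * f x + (\<tau> / t) * f (x + t *\<^sub>R d)"
      by metis
    then have "f (x + \<tau> *\<^sub>R d) - f x \<le> \<tau> * ((f (x + t *\<^sub>R d) - f x) / t)"
      by (simp add: algebra_simps diff_divide_distrib)
    then show ?case
      using elim by (simp add: field_simps)
  qed
  then have "l \<le> (f (x + t *\<^sub>R d) - f x) / t"
    using assms(2) unfolding has_dir_deriv_def
    by (intro tendsto_upperbound[where F = "at_right (0::real)"]) auto
  then show ?thesis
    using assms(3) by (simp add: field_simps)
qed

section \<open>Gradients, quadratic bounds and the error of the model\<close>

lemma GDERIV_gradient:
  fixes f :: "'a::euclidean_space \<Rightarrow> real"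
  assumes "f differentiable (at x)"
  shows "GDERIV f x :> gradient f x"
proof -
  obtain f' where f': "(f has_derivative f') (at x)"
    using assms unfolding differentiable_def by blast
  then have "linear f'"
    by (rule has_derivative_linear)
  \<comment> \<open>Riesz representation of the linear functional \<open>f'\<close>; with uniqueness
    below it makes the \<open>THE\<close> in \<open>gradient\<close> meaningful.\<close>
  then have "f' = (\<lambda>h. h \<bullet> adjoint f' 1)"
    using adjoint_works[of f' _ 1] by auto
  then have "GDERIV f x :> adjoint f' 1"
    using f' unfolding gderiv_def by metis
  moreover have "D = adjoint f' 1" if "GDERIV f x :> D" for D
  proof -
    have "(\<lambda>h. h \<bullet> D) = (\<lambda>h. h \<bullet> adjoint f' 1)"
      using that \<open>GDERIV f x :> adjoint f' 1\<close> unfolding gderiv_def by (rule has_derivative_unique)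
    then show ?thesis
      by (metis vector_eq_rdot inner_commute)
  qed
  ultimately have "\<exists>!D. GDERIV f x :> D"
    by (rule ex1I)
  then show ?thesis
    unfolding gradient_def by (rule theI')
qed

text \<open>The gap between the two sides along the segment, \<open>\<phi>\<close>, has nonpositive
  derivative on [0,1]. Only gradient differences from the base point \<open>z\<close> enter.\<close>

lemma gradient_lipschitz_quadratic_upper_bound:
  fixes f :: "'a::real_inner \<Rightarrow> real"
  assumes der: "\<And>t. 0 \<le> t \<Longrightarrow> t \<le> 1 \<Longrightarrow> GDERIV f (z + t *\<^sub>R s) :> G (z + t *\<^sub>R s)"
    and lip: "\<And>t. 0 \<le> t \<Longrightarrow> t \<le> 1 \<Longrightarrow> norm (G (z + t *\<^sub>R s) - G z) \<le> C * norm (t *\<^sub>R s)"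
  shows "f (z + s) - f z - G z \<bullet> s \<le> C / 2 * (norm s)\<^sup>2"
proof -
  define \<phi> where "\<phi> t = f (z + t *\<^sub>R s) - t * (G z \<bullet> s) - C / 2 * t\<^sup>2 * (norm s)\<^sup>2" for t
  have "\<exists>y. DERIV \<phi> t :> y \<and> y \<le> 0" if "0 \<le> t" "t \<le> 1" for t
  proof (intro exI conjI)
    have "((\<lambda>t. f (z + t *\<^sub>R s)) has_derivative (\<lambda>h. (h *\<^sub>R s) \<bullet> G (z + t *\<^sub>R s))) (at t)"
      by (rule has_derivative_compose[where f = "\<lambda>t. z + t *\<^sub>R s", OF _ der[OF that, unfolded gderiv_def]])
        (auto intro!: derivative_eq_intros)
    then have "DERIV (\<lambda>t. f (z + t *\<^sub>R s)) t :> G (z + t *\<^sub>R s) \<bullet> s"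
      unfolding has_field_derivative_def
      by (rule has_derivative_eq_rhs) (auto simp: inner_commute)
    then show "DERIV \<phi> t :> G (z + t *\<^sub>R s) \<bullet> s - G z \<bullet> s - C * t * (norm s)\<^sup>2"
      unfolding \<phi>_def by (auto intro!: derivative_eq_intros)
    have "(G (z + t *\<^sub>R s) - G z) \<bullet> s \<le> norm (G (z + t *\<^sub>R s) - G z) * norm s"
      by (rule norm_cauchy_schwarz)
    also have "\<dots> \<le> C * norm (t *\<^sub>R s) * norm s"
      by (intro mult_right_mono lip that) auto
    also have "\<dots> = C * t * (norm s)\<^sup>2"
      using that by (simp add: power2_eq_square)
    finally show "G (z + t *\<^sub>R s) \<bullet> s - G z \<bullet> s - C * t * (norm s)\<^sup>2 \<le> 0"
      by (simp add: inner_diff_left)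
  qed
  then have "\<phi> 1 \<le> \<phi> 0"
    by (rule DERIV_nonpos_imp_nonincreasing[OF zero_le_one])
  then show ?thesis
    by (simp add: \<phi>_def)
qed

text \<open>Dividing by \<open>a\<close> moves the coefficients into the unit ball. The supremum
  bounds its members because the set is bounded above, by the sum of the norms of the
  columns.\<close>

lemma norm_sum_le_spectral_norm:
  assumes "L2_set w {1..J} \<le> a" "a > 0"
  shows "norm (\<Sum>j=1..J. w j *\<^sub>R v j) \<le> a * spectral_norm J v"
proof -
  define w' where "w' j = w j / a" for j
  have "L2_set w' {1..J} = L2_set w {1..J} / a"
    using assms(2) L2_set_left_distrib[of "1 / a" w "{1..J}"] by (simp add: w'_def[abs_def])
  then have w': "L2_set w' {1..J} \<le> 1"
    using assms by simp
  have "norm (\<Sum>j=1..J. x j *\<^sub>R v j) \<le> (\<Sum>j=1..J. norm (v j))" if "L2_set x {1..J} \<le> 1" for x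
  proof (rule sum_norm_le)
    fix j assume j: "j \<in> {1..J}"
    have "\<bar>x j\<bar> \<le> L2_set (\<lambda>j. \<bar>x j\<bar>) {1..J}"
      using j by (intro member_le_L2_set) auto
    also have "\<dots> = L2_set x {1..J}"
      by (simp add: L2_set_def)
    finally show "norm (x j *\<^sub>R v j) \<le> norm (v j)"
      using that by (simp add: mult_left_le_one_le)
  qed
  then have "bdd_above {norm (\<Sum>j=1..J. w j *\<^sub>R v j) | w. L2_set w {1..J} \<le> 1}"
    by (intro bdd_aboveI) auto
  then have "norm (\<Sum>j=1..J. w' j *\<^sub>R v j) \<le> spectral_norm J v"
    unfolding spectral_norm_def using w' by (intro cSup_upper) auto
  moreover have "(\<Sum>j=1..J. w j *\<^sub>R v j) = a *\<^sub>R (\<Sum>j=1..J. w' j *\<^sub>R v j)"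
    using assms(2) by (simp add: scaleR_sum_right w'_def)
  ultimately show ?thesis
    using assms(2) by simp
qed

text \<open>\<open>H\<close> enters the model exactly, so only the linearization errors of
  \<open>F\<close> and of the \<open>c j\<close> count; the latter are bounded jointly through the
  spectral norm.\<close>

lemma model_error:
  fixes F H :: "'a::euclidean_space \<Rightarrow> real"
  assumes F: "\<And>x. F differentiable (at x)"
    and c: "\<And>j x. j \<in> {1..J} \<Longrightarrow> c j differentiable (at x)"
    and lip: "\<And>t. 0 \<le> t \<Longrightarrow> t \<le> 1 \<Longrightarrow>
        norm (gradient F (z + t *\<^sub>R s) - gradient F z) \<le> KbF * norm (t *\<^sub>R s) \<and>
        spectral_norm J (\<lambda>j. gradient (c j) (z + t *\<^sub>R s) - gradient (c j) z) \<le> Kbc * norm (t *\<^sub>R s)"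
  shows "\<bar>F (z + s) + H (z + s) + (\<Sum>j=1..J. \<bar>c j (z + s)\<bar>)
      - (model F H c J z \<rho> s - \<rho> / 2 * (norm s)\<^sup>2)\<bar> \<le> (KbF + sqrt J * Kbc) / 2 * (norm s)\<^sup>2"
proof -
  define e where "e = (\<lambda>f. f (z + s) - f z - gradient f z \<bullet> s :: real)"
  have "e F \<le> KbF / 2 * (norm s)\<^sup>2"
    unfolding e_def using GDERIV_gradient[OF F] lip
    by (intro gradient_lipschitz_quadratic_upper_bound) auto
  \<comment> \<open>The quadratic bound is one-sided; applied to \<open>- F\<close> it gives the
    other side.\<close>
  moreover have "- e F \<le> KbF / 2 * (norm s)\<^sup>2"
  proof -
    have "GDERIV (\<lambda>x. - F x) x :> - gradient F x" for x
      by (rule GDERIV_minus[OF GDERIV_gradient[OF F]])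
    then have "- F (z + s) - - F z - (- gradient F z) \<bullet> s \<le> KbF / 2 * (norm s)\<^sup>2"
      using lip by (intro gradient_lipschitz_quadratic_upper_bound[where G = "\<lambda>x. - gradient F x"])
        (auto simp: norm_minus_commute)
    then show ?thesis
      by (simp add: e_def)
  qed
  ultimately have eF: "\<bar>e F\<bar> \<le> KbF / 2 * (norm s)\<^sup>2"
    by linarith
  have ec: "(\<Sum>j=1..J. \<bar>e (c j)\<bar>) \<le> sqrt J * Kbc / 2 * (norm s)\<^sup>2"
  \<comment> \<open>The factor \<open>sqrt J\<close> must be positive for
    \<open>norm_sum_le_spectral_norm\<close>.\<close>
  proof (cases "J = 0")
    case False
    \<comment> \<open>With the signs of the errors as coefficients, the sum of absolute errors is
      the linearization error of the single function \<open>h\<close>. The sign vector has Euclidean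
      norm \<open>sqrt J\<close>, the source of this factor.\<close>
    define w where "w j = (if e (c j) \<ge> 0 then 1 else - 1 :: real)" for j
    define h where "h x = (\<Sum>j=1..J. w j * c j x)" for x
    define G where "G x = (\<Sum>j=1..J. w j *\<^sub>R gradient (c j) x)" for x
    have w: "L2_set w {1..J} \<le> sqrt J"
    proof -
      have "(w j)\<^sup>2 = 1" for j by (simp add: w_def)
      then show ?thesis by (simp add: L2_set_def)
    qed
    have "GDERIV h x :> G x" for x
    proof -
      have "((\<lambda>x. \<Sum>j=1..J. w j * c j x) has_derivative (\<lambda>y. \<Sum>j=1..J. w j * (y \<bullet> gradient (c j) x))) (at x)"
        using GDERIV_gradient[OF c] unfolding gderiv_def
        by (intro has_derivative_sum has_derivative_mult_right) auto
      then show ?thesis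
        unfolding gderiv_def h_def[abs_def] G_def
        by (rule has_derivative_eq_rhs) (auto simp: inner_sum_right)
    qed
    moreover have "norm (G (z + t *\<^sub>R s) - G z) \<le> sqrt J * Kbc * norm (t *\<^sub>R s)" if "0 \<le> t" "t \<le> 1" for t
    proof -
      have "G (z + t *\<^sub>R s) - G z = (\<Sum>j=1..J. w j *\<^sub>R (gradient (c j) (z + t *\<^sub>R s) - gradient (c j) z))"
        by (simp add: G_def sum_subtractf algebra_simps)
      also have "norm \<dots> \<le> sqrt J * spectral_norm J (\<lambda>j. gradient (c j) (z + t *\<^sub>R s) - gradient (c j) z)"
        using w False by (intro norm_sum_le_spectral_norm) auto
      also have "\<dots> \<le> sqrt J * (Kbc * norm (t *\<^sub>R s))"
        using lip[OF that] by (intro mult_left_mono) auto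
      finally show ?thesis by simp
    qed
    ultimately have "h (z + s) - h z - G z \<bullet> s \<le> sqrt J * Kbc / 2 * (norm s)\<^sup>2"
      by (intro gradient_lipschitz_quadratic_upper_bound) auto
    moreover have "h (z + s) - h z - G z \<bullet> s = (\<Sum>j=1..J. \<bar>e (c j)\<bar>)"
    proof -
      have "h (z + s) - h z - G z \<bullet> s = (\<Sum>j=1..J. w j * e (c j))"
        by (simp add: h_def G_def e_def inner_sum_left sum_subtractf sum.distrib algebra_simps)
      also have "\<dots> = (\<Sum>j=1..J. \<bar>e (c j)\<bar>)"
        by (intro sum.cong) (auto simp: w_def)
      finally show ?thesis .
    qed
    ultimately show ?thesis by simp
  qed simp
  have "\<bar>(\<Sum>j=1..J. \<bar>c j (z + s)\<bar>) - (\<Sum>j=1..J. \<bar>c j z + gradient (c j) z \<bullet> s\<bar>)\<bar> \<le> (\<Sum>j=1..J. \<bar>e (c j)\<bar>)"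
    unfolding sum_subtractf[symmetric] e_def by (rule order_trans[OF sum_abs]) (intro sum_mono, linarith)
  moreover have "(KbF + sqrt J * Kbc) / 2 * (norm s)\<^sup>2
      = KbF / 2 * (norm s)\<^sup>2 + sqrt J * Kbc / 2 * (norm s)\<^sup>2"
    by (simp add: add_divide_distrib distrib_right)
  ultimately show ?thesis
    using eF ec unfolding model_def e_def by linarith
qed

section \<open>Minimizers of a function plus a proximal term\<close>

lemma proximal_minimizer_exists:
  fixes f :: "'a::euclidean_space \<Rightarrow> real"
  assumes "continuous_on UNIV f" "level_bounded f" "\<gamma> \<ge> 0"
  obtains y where "\<And>x. f y + \<gamma> / 2 * (norm (y - z))\<^sup>2 \<le> f x + \<gamma> / 2 * (norm (x - z))\<^sup>2"
proof -
  define h where "h x = f x + \<gamma> / 2 * (norm (x - z))\<^sup>2" for x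
  have cont: "continuous_on UNIV h"
    unfolding h_def using assms(1) by (intro continuous_intros)
  \<comment> \<open>The proximal term vanishes at \<open>z\<close> and is nonnegative, so level
    boundedness passes from \<open>f\<close> to \<open>h\<close>.\<close>
  have "lev h (h z) \<subseteq> lev f (f z)"
  proof
    fix x assume "x \<in> lev h (h z)"
    then have "f x + \<gamma> / 2 * (norm (x - z))\<^sup>2 \<le> f z" by (simp add: lev_def h_def)
    moreover have "0 \<le> \<gamma> / 2 * (norm (x - z))\<^sup>2" using assms(3) by simp
    ultimately show "x \<in> lev f (f z)" by (simp add: lev_def)
  qed
  then have "bounded (lev h (h z))"
    using assms(2) bounded_subset unfolding level_bounded_def by blast
  moreover have "closed (lev h (h z))"
    unfolding lev_def by (rule closed_Collect_le[OF cont continuous_on_const])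
  ultimately have "compact (lev h (h z))"
    by (simp add: compact_eq_bounded_closed)
  moreover have z: "z \<in> lev h (h z)"
    by (simp add: lev_def)
  ultimately have "\<exists>y\<in>lev h (h z). \<forall>x\<in>lev h (h z). h y \<le> h x"
    by (intro continuous_attains_inf continuous_on_subset[OF cont subset_UNIV]) auto
  then obtain y where y: "\<And>x. x \<in> lev h (h z) \<Longrightarrow> h y \<le> h x"
    by metis
  have "h y \<le> h x" for x
    using y[of x] y[OF z] by (cases "h x \<le> h z") (auto simp: lev_def)
  then show ?thesis
    unfolding h_def by (rule that)
qed

text \<open>Expanding the square along the ray and dividing by \<open>t\<close> bounds the quotients
  of \<open>f\<close> from below; the first-order term that survives in the limit is estimated by
  Cauchy-Schwarz.\<close>

lemma proximal_minimizer_dir_deriv: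
  fixes f :: "'a::real_inner \<Rightarrow> real"
  assumes "\<And>x. f y + \<gamma> / 2 * (norm (y - z))\<^sup>2 \<le> f x + \<gamma> / 2 * (norm (x - z))\<^sup>2"
    and "\<gamma> \<ge> 0" "has_dir_deriv f y d l"
  shows "l \<ge> - (\<gamma> * norm (y - z) * norm d)"
proof -
  have "\<forall>\<^sub>F t in at_right 0. - \<gamma> * ((y - z) \<bullet> d) - \<gamma> / 2 * t * (norm d)\<^sup>2 \<le> (f (y + t *\<^sub>R d) - f y) /\<^sub>R t"
    using eventually_at_right_less[of "0::real"]
  proof eventually_elim
    case (elim t)
    have eq: "(norm (y + t *\<^sub>R d - z))\<^sup>2 = (norm (y - z))\<^sup>2 + 2 * t * ((y - z) \<bullet> d) + t\<^sup>2 * (norm d)\<^sup>2"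
      using dot_norm[of "y - z" "t *\<^sub>R d"] by (simp add: diff_add_eq power_mult_distrib)
    have "f y + \<gamma> / 2 * (norm (y - z))\<^sup>2
        \<le> f (y + t *\<^sub>R d) + \<gamma> / 2 * ((norm (y - z))\<^sup>2 + 2 * t * ((y - z) \<bullet> d) + t\<^sup>2 * (norm d)\<^sup>2)"
      using assms(1)[of "y + t *\<^sub>R d"] unfolding eq .
    then have "t * (- \<gamma> * ((y - z) \<bullet> d) - \<gamma> / 2 * t * (norm d)\<^sup>2) \<le> f (y + t *\<^sub>R d) - f y"
      by (simp add: algebra_simps power2_eq_square)
    with elim show ?case by (simp add: field_simps)
  qed
  moreover have "((\<lambda>t. - \<gamma> * ((y - z) \<bullet> d) - \<gamma> / 2 * t * (norm d)\<^sup>2) \<longlongrightarrow>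
      - \<gamma> * ((y - z) \<bullet> d) - \<gamma> / 2 * 0 * (norm d)\<^sup>2) (at_right 0)"
    by (intro tendsto_intros)
  ultimately have "- \<gamma> * ((y - z) \<bullet> d) - \<gamma> / 2 * 0 * (norm d)\<^sup>2 \<le> l"
    using assms(3) unfolding has_dir_deriv_def by (intro tendsto_le[of "at_right (0::real)"]) auto
  moreover have "\<gamma> * ((y - z) \<bullet> d) \<le> \<gamma> * (norm (y - z) * norm d)"
    using assms(2) norm_cauchy_schwarz by (intro mult_left_mono) auto
  ultimately show ?thesis by simp
qed

section \<open>Iteration complexity of the algorithm\<close>

text \<open>Here \<open>a\<close> stands for objective values and \<open>b\<close> for squared step
  lengths. With \<open>u\<close> rejections so far the parameter is
  \<open>\<rho> 1 * \<eta>2 ^ u\<close>, and a further rejection needs it below \<open>C\<close>, so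
  there are at most \<open>p\<close>. Every other step decreases \<open>a\<close> by at least
  \<open>w\<close>, since \<open>\<rho>\<close> never falls below \<open>\<rho> 1\<close>.\<close>

lemma descent_with_few_rejections:
  fixes a b \<rho> :: "nat \<Rightarrow> real"
  assumes step: "\<And>k. k \<in> {1..N} \<Longrightarrow>
        a (k + 1) \<le> a k - \<eta>1 * \<rho> k / 2 * b k \<and> \<rho> (k + 1) = \<rho> k \<or>
        \<rho> k < C \<and> a (k + 1) \<le> a k \<and> \<rho> (k + 1) = \<eta>2 * \<rho> k"
    and b: "\<And>k. k \<in> {1..N} \<Longrightarrow> b k \<ge> q" "q \<ge> 0"
    and "\<rho> 1 > 0" "\<eta>1 > 0" "\<eta>2 > 1" and C: "C \<le> \<rho> 1 * \<eta>2 ^ p"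
  shows "a (N + 1) \<le> a 1 - (real N - real p) * (\<eta>1 * \<rho> 1 / 2 * q)"
proof -
  define w where "w = \<eta>1 * \<rho> 1 / 2 * q"
  have w: "w \<ge> 0"
    using assms by (simp add: w_def)
  have "\<exists>u\<le>p. \<rho> (n + 1) = \<rho> 1 * \<eta>2 ^ u \<and> a (n + 1) \<le> a 1 - (real n - real u) * w" if "n \<le> N" for n
    using that
  proof (induction n)
    case 0
    then show ?case by (intro exI[of _ 0]) simp
  next
    case (Suc n)
    then obtain u where u: "u \<le> p" "\<rho> (n + 1) = \<rho> 1 * \<eta>2 ^ u" "a (n + 1) \<le> a 1 - (real n - real u) * w"
      by auto
    have n: "n + 1 \<in> {1..N}"
      using Suc.prems by simp
    from step[OF n] show ?case
    proof
      assume acc: "a (n + 1 + 1) \<le> a (n + 1) - \<eta>1 * \<rho> (n + 1) / 2 * b (n + 1) \<and> \<rho> (n + 1 + 1) = \<rho> (n + 1)"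
      have "\<rho> 1 * 1 \<le> \<rho> (n + 1)"
        unfolding u(2) using assms by (intro mult_left_mono) auto
      then have "w \<le> \<eta>1 * \<rho> (n + 1) / 2 * b (n + 1)"
        unfolding w_def using assms b(1)[OF n] by (intro mult_mono) auto
      with acc u show ?thesis
        by (intro exI[of _ u]) (simp add: algebra_simps)
    next
      assume rej: "\<rho> (n + 1) < C \<and> a (n + 1 + 1) \<le> a (n + 1) \<and> \<rho> (n + 1 + 1) = \<eta>2 * \<rho> (n + 1)"
      then have "\<rho> 1 * \<eta>2 ^ u < \<rho> 1 * \<eta>2 ^ p"
        using C u(2) by linarith
      then have "u < p"
        using assms by (simp add: power_strict_increasing_iff)
      with rej u show ?thesis
        by (intro exI[of _ "Suc u"]) (simp add: algebra_simps)
    qed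
  qed
  from this[of N] obtain u where "u \<le> p" "a (N + 1) \<le> a 1 - (real N - real u) * w"
    by auto
  moreover have "(real N - real p) * w \<le> (real N - real u) * w"
    using \<open>u \<le> p\<close> w by (intro mult_right_mono) auto
  ultimately show ?thesis
    unfolding w_def by linarith
qed

section \<open>A run of the algorithm and its model steps\<close>

locale srpa =
  fixes F H \<Theta> :: "'a::euclidean_space \<Rightarrow> real" and c :: "nat \<Rightarrow> 'a \<Rightarrow> real" and J m :: nat
    and P :: "nat \<Rightarrow> 'a set" and \<eta>1 \<eta>2 \<delta> :: real
    and z s :: "nat \<Rightarrow> 'a" and \<rho> :: "nat \<Rightarrow> real" and T :: enat
    and KF KbF Kbc r \<Theta>min :: real
  assumes F_differentiable: "F differentiable (at x)"
    and c_differentiable: "j \<in> {1..J} \<Longrightarrow> c j differentiable (at x)"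
    and F_nonneg: "F x \<ge> 0" and H_nonneg: "H x \<ge> 0" and H_continuous: "continuous_on UNIV H"
    and \<Theta>_eq: "\<Theta> x = F x + H x + (\<Sum>j=1..J. \<bar>c j x\<bar>)"
    and \<Theta>_level_bounded: "level_bounded \<Theta>" and \<Theta>min_le: "\<Theta>min \<le> \<Theta> x"
    and cover: "(\<Union>i\<in>{1..m}. P i) = UNIV"
    and \<rho>1: "\<rho> 1 > 0" and \<eta>1: "0 < \<eta>1" "\<eta>1 < 1" and \<eta>2: "\<eta>2 > 1" and \<delta>: "\<delta> > 0"
    and run: "srpa_run \<Theta> F H c J m P \<eta>1 \<eta>2 \<delta> z \<rho> s T"
    and r_eq: "r = 2 * KF / \<rho> 1 + sqrt (2 * \<Theta> (z 1) / \<rho> 1)"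
    and KF: "KF > 0" "x \<in> lev \<Theta> (\<Theta> (z 1)) \<Longrightarrow> norm (gradient F x) \<le> KF"
    and KbF: "KbF > 0" and Kbc: "Kbc > 0"
    and lip: "x \<in> {a + b | a b. a \<in> lev \<Theta> (\<Theta> (z 1)) \<and> b \<in> cball 0 r} \<Longrightarrow>
                y \<in> {a + b | a b. a \<in> lev \<Theta> (\<Theta> (z 1)) \<and> b \<in> cball 0 r} \<Longrightarrow>
           norm (gradient F x - gradient F y) \<le> KbF * norm (x - y) \<and>
           spectral_norm J (\<lambda>j. gradient (c j) x - gradient (c j) y) \<le> Kbc * norm (x - y)"
begin

abbreviation "\<Phi> k \<equiv> model F H c J (z k) (\<rho> k)"

definition Kb :: real where "Kb = KbF + sqrt J * Kbc"

lemma Kb_pos: "Kb > 0"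
  unfolding Kb_def using KbF Kbc by (intro add_pos_nonneg) auto

lemma \<Theta>_nonneg: "\<Theta> x \<ge> 0"
  unfolding \<Theta>_eq using F_nonneg H_nonneg by (intro add_nonneg_nonneg sum_nonneg) auto

lemma r_pos: "r > 0"
  unfolding r_eq using KF \<rho>1 \<Theta>_nonneg by (intro add_pos_nonneg) auto

lemma \<Theta>_continuous: "continuous_on UNIV \<Theta>"
proof -
  have "continuous_on UNIV F" "\<And>j. j \<in> {1..J} \<Longrightarrow> continuous_on UNIV (c j)"
    using F_differentiable c_differentiable
    by (auto intro!: differentiable_imp_continuous_on simp: differentiable_on_def)
  then show ?thesis
    unfolding \<Theta>_eq[abs_def] using H_continuous by (intro continuous_intros) auto
qed

lemma model_zero: "model F H c J x \<rho>' 0 = \<Theta> x"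
  by (simp add: model_def \<Theta>_eq)

text \<open>The segment from \<open>x\<close> to \<open>x + v\<close> stays in the enlarged level
  set on which the Lipschitz constants are valid.\<close>

lemma model_approximates:
  assumes x: "\<Theta> x \<le> \<Theta> (z 1)" and v: "norm v \<le> r"
  shows "\<bar>\<Theta> (x + v) - (model F H c J x \<rho>' v - \<rho>' / 2 * (norm v)\<^sup>2)\<bar> \<le> Kb / 2 * (norm v)\<^sup>2"
  unfolding \<Theta>_eq Kb_def
proof (rule model_error[OF F_differentiable c_differentiable])
  fix t :: real assume t: "0 \<le> t" "t \<le> 1"
  have "norm (t *\<^sub>R v) \<le> r"
    using mult_left_le_one_le[of "norm v" t] t v by simp
  then have "x + t *\<^sub>R v \<in> {a + b | a b. a \<in> lev \<Theta> (\<Theta> (z 1)) \<and> b \<in> cball 0 r}"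
    using x by (intro CollectI exI[of _ x] exI[of _ "t *\<^sub>R v"]) (auto simp: lev_def)
  moreover have "x \<in> {a + b | a b. a \<in> lev \<Theta> (\<Theta> (z 1)) \<and> b \<in> cball 0 r}"
    using x r_pos by (intro CollectI exI[of _ x] exI[of _ 0]) (auto simp: lev_def)
  ultimately show "norm (gradient F (x + t *\<^sub>R v) - gradient F x) \<le> KbF * norm (t *\<^sub>R v) \<and>
      spectral_norm J (\<lambda>j. gradient (c j) (x + t *\<^sub>R v) - gradient (c j) x) \<le> Kbc * norm (t *\<^sub>R v)"
    using lip[of "x + t *\<^sub>R v" x] by simp
qed

text \<open>This explains the radius \<open>r\<close>: dropping the nonnegative terms of the model
  leaves, for the length \<open>n\<close>, the inequality
  \<open>n\<^sup>2 \<le> A * n + B\<^sup>2\<close>, which fails when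
  \<open>n > A + B\<close>.\<close>

lemma step_norm_le:
  assumes x: "\<Theta> x \<le> \<Theta> (z 1)" and \<rho>': "\<rho>' \<ge> \<rho> 1" and v: "model F H c J x \<rho>' v \<le> \<Theta> x"
  shows "norm v \<le> r"
proof (rule ccontr)
  define A B n where "A = 2 * KF / \<rho> 1" and "B = sqrt (2 * \<Theta> (z 1) / \<rho> 1)" and "n = norm v"
  have B: "B \<ge> 0" "B\<^sup>2 = 2 * \<Theta> (z 1) / \<rho> 1"
    using \<rho>1 \<Theta>_nonneg[of "z 1"] by (auto simp: B_def)
  have A: "A > 0"
    using KF \<rho>1 by (simp add: A_def)
  assume "\<not> norm v \<le> r"
  then have n: "n > A + B"
    by (simp add: r_eq A_def B_def n_def)
  have "- (KF * n) \<le> gradient F x \<bullet> v"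
  proof -
    have "\<bar>gradient F x \<bullet> v\<bar> \<le> norm (gradient F x) * n"
      unfolding n_def by (rule Cauchy_Schwarz_ineq2)
    also have "\<dots> \<le> KF * n"
      using KF x by (intro mult_right_mono) (auto simp: n_def lev_def)
    finally show ?thesis by linarith
  qed
  moreover have "\<rho> 1 / 2 * n\<^sup>2 \<le> \<rho>' / 2 * (norm v)\<^sup>2"
    unfolding n_def using \<rho>' by (intro mult_right_mono) auto
  moreover have "0 \<le> (\<Sum>j=1..J. \<bar>c j x + gradient (c j) x \<bullet> v\<bar>)"
    by (intro sum_nonneg) auto
  ultimately have "\<rho> 1 / 2 * n\<^sup>2 \<le> KF * n + \<Theta> (z 1)"
    using v x F_nonneg[of x] H_nonneg[of "x + v"] unfolding model_def by linarith
  then have "n\<^sup>2 \<le> A * n + B\<^sup>2"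
    using \<rho>1 unfolding B(2) A_def by (simp add: field_simps)
  moreover have "(A + B) * n < n * n"
    using n A B by (intro mult_strict_right_mono) auto
  moreover have "B * B \<le> B * n"
    using n A B by (intro mult_left_mono) auto
  ultimately show False
    by (simp add: power2_eq_square algebra_simps)
qed

text \<open>The acceptance test uses only the fraction \<open>\<eta>1\<close> of the quadratic term;
  for large \<open>\<rho>'\<close> the remaining fraction absorbs the model error.\<close>

lemma sufficient_decrease:
  assumes x: "\<Theta> x \<le> \<Theta> (z 1)" and \<rho>': "\<rho>' \<ge> \<rho> 1" "\<rho>' \<ge> Kb / (1 - \<eta>1)"
    and v: "model F H c J x \<rho>' v \<le> \<Theta> x"
  shows "\<Theta> x - \<Theta> (x + v) \<ge> \<eta>1 * \<rho>' / 2 * (norm v)\<^sup>2"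
proof -
  have "\<Theta> (x + v) \<le> model F H c J x \<rho>' v - \<rho>' / 2 * (norm v)\<^sup>2 + Kb / 2 * (norm v)\<^sup>2"
    using model_approximates[OF x step_norm_le[OF x \<rho>'(1) v], of \<rho>'] by linarith
  moreover have "Kb / 2 \<le> \<rho>' / 2 - \<eta>1 * \<rho>' / 2"
    using \<rho>'(2) \<eta>1 by (simp add: field_simps)
  then have "Kb / 2 * (norm v)\<^sup>2 \<le> (\<rho>' / 2 - \<eta>1 * \<rho>' / 2) * (norm v)\<^sup>2"
    by (rule mult_right_mono) simp
  ultimately show ?thesis
    using v by (simp add: algebra_simps)
qed

section \<open>Properties of the iterations\<close>

lemma T_ge_1: "enat 1 \<le> T"
  using run unfolding srpa_run_def by (simp add: one_enat_def)

context
  fixes k :: nat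
  assumes k: "k \<ge> 1" "enat k \<le> T"
begin

lemma iteration:
  "\<exists>t. (\<forall>i\<in>active m P \<delta> (z k). is_arg_min (\<Phi> k) (\<lambda>v. v \<in> (\<lambda>x. x - z k) ` P i) (t i)) \<and>
       is_arg_min (\<Phi> k) (\<lambda>v. v \<in> t ` active m P \<delta> (z k)) (s k)"
  "enat k = T \<longleftrightarrow> \<Phi> k (s k) = \<Phi> k 0"
  "enat k < T \<Longrightarrow> (z (k + 1), \<rho> (k + 1)) =
     (if \<Theta> (z k) - \<Theta> (z k + s k) \<ge> \<eta>1 * \<rho> k / 2 * (norm (s k))\<^sup>2
      then (z k + s k, \<rho> k) else (z k, \<eta>2 * \<rho> k))"
  using run k unfolding srpa_run_def Let_def by blast+

text \<open>The polyhedron containing \<open>z k + v\<close> is within distance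
  \<open>\<delta>\<close> of \<open>z k\<close>, hence active, and its subproblem admits
  \<open>v\<close>.\<close>

lemma step_minimizes_model:
  assumes "norm v \<le> \<delta>"
  shows "\<Phi> k (s k) \<le> \<Phi> k v"
proof -
  obtain t where t: "\<And>i. i \<in> active m P \<delta> (z k) \<Longrightarrow> is_arg_min (\<Phi> k) (\<lambda>v. v \<in> (\<lambda>x. x - z k) ` P i) (t i)"
    and s: "is_arg_min (\<Phi> k) (\<lambda>v. v \<in> t ` active m P \<delta> (z k)) (s k)"
    using iteration(1) by blast
  obtain i where i: "i \<in> {1..m}" "z k + v \<in> P i"
    using cover by blast
  have "infdist (z k) (P i) \<le> dist (z k) (z k + v)"
    using i by (intro infdist_le)
  then have act: "i \<in> active m P \<delta> (z k)"
    using i assms by (simp add: active_def dist_norm)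
  have "v \<in> (\<lambda>x. x - z k) ` P i"
    using i by (intro image_eqI[of _ _ "z k + v"]) auto
  then have "\<Phi> k (t i) \<le> \<Phi> k v"
    using t[OF act] unfolding is_arg_min_linorder by blast
  moreover have "\<Phi> k (s k) \<le> \<Phi> k (t i)"
    using s act unfolding is_arg_min_linorder by blast
  ultimately show ?thesis by linarith
qed

lemma model_decreases: "\<Phi> k (s k) \<le> \<Theta> (z k)"
  using step_minimizes_model[of 0] \<delta> by (simp add: model_zero)

end

text \<open>A rejection needs \<open>\<rho> k\<close> below \<open>Kb / (1 - \<eta>1)\<close>, so an
  increased parameter is below \<open>\<eta>2\<close> times this threshold.\<close>

definition \<rho>max :: real where "\<rho>max = max (\<rho> 1) (\<eta>2 * (Kb / (1 - \<eta>1)))"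

text \<open>The second alternative is the contrapositive of \<open>sufficient_decrease\<close>; the
  disjunction has the form that \<open>descent_with_few_rejections\<close> expects.\<close>

lemma progress:
  assumes k: "k \<ge> 1" "enat k < T" and "\<Theta> (z k) \<le> \<Theta> (z 1)" "\<rho> k \<ge> \<rho> 1"
  shows "\<Theta> (z (k + 1)) \<le> \<Theta> (z k) - \<eta>1 * \<rho> k / 2 * (norm (s k))\<^sup>2 \<and> \<rho> (k + 1) = \<rho> k \<or>
    \<rho> k < Kb / (1 - \<eta>1) \<and> \<Theta> (z (k + 1)) \<le> \<Theta> (z k) \<and> \<rho> (k + 1) = \<eta>2 * \<rho> k"
proof (cases "\<Theta> (z k) - \<Theta> (z k + s k) \<ge> \<eta>1 * \<rho> k / 2 * (norm (s k))\<^sup>2")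
  case True
  then show ?thesis
    using iteration(3)[of k] k by auto
next
  case False
  then have "\<rho> k < Kb / (1 - \<eta>1)"
    using sufficient_decrease[of "z k" "\<rho> k" "s k"] model_decreases[of k] assms by fastforce
  with False show ?thesis
    using iteration(3)[of k] k by auto
qed

lemma invariant:
  assumes "k \<ge> 1" "enat k \<le> T"
  shows "\<Theta> (z k) \<le> \<Theta> (z 1) \<and> \<rho> 1 \<le> \<rho> k \<and> \<rho> k \<le> \<rho>max"
  using assms
proof (induction k rule: dec_induct)
  case base
  then show ?case by (simp add: \<rho>max_def)
next
  case (step k)
  have kT: "enat k < T"
    using step.prems by (metis Suc_ile_eq)
  then have IH: "\<Theta> (z k) \<le> \<Theta> (z 1)" "\<rho> 1 \<le> \<rho> k" "\<rho> k \<le> \<rho>max"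
    using step.IH by auto
  have k: "k \<ge> 1" using step by simp
  show ?case
    using progress[OF k kT IH(1,2)]
  proof
    assume acc: "\<Theta> (z (k + 1)) \<le> \<Theta> (z k) - \<eta>1 * \<rho> k / 2 * (norm (s k))\<^sup>2 \<and> \<rho> (k + 1) = \<rho> k"
    have "0 \<le> \<eta>1 * \<rho> k / 2 * (norm (s k))\<^sup>2"
      using \<eta>1 IH(2) \<rho>1 by simp
    with acc IH show ?thesis by simp
  next
    assume rej: "\<rho> k < Kb / (1 - \<eta>1) \<and> \<Theta> (z (k + 1)) \<le> \<Theta> (z k) \<and> \<rho> (k + 1) = \<eta>2 * \<rho> k"
    then have "\<eta>2 * \<rho> k \<le> \<eta>2 * (Kb / (1 - \<eta>1))"
      using \<eta>2 by (intro mult_left_mono) auto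
    moreover have "1 * \<rho> k \<le> \<eta>2 * \<rho> k"
      using \<eta>2 \<rho>1 IH by (intro mult_right_mono) auto
    ultimately show ?thesis
      using rej IH by (simp add: \<rho>max_def)
  qed
qed

text \<open>
  Minimality of \<open>y\<close> is compared with \<open>z k + v\<close>. The first bound on \<open>\<gamma>\<close> yields the factor 3; the other
  two keep \<open>y\<close> where the model error bound and the optimality of the step apply.
\<close>

lemma proximal_point_near_iterate:
  assumes k: "k \<ge> 1" "enat k \<le> T"
    and v: "\<Phi> k v = \<Phi> k (s k)" "norm v \<le> r"
    and \<gamma>: "\<gamma> \<ge> \<rho>max + 2 * Kb" "2 * (\<Theta> (z 1) - \<Theta>min) \<le> \<gamma> * r\<^sup>2" "2 * (\<Theta> (z 1) - \<Theta>min) \<le> \<gamma> * \<delta>\<^sup>2"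
  obtains y where "\<Theta> y \<le> \<Theta> (z 1)" "(norm (y - z k))\<^sup>2 \<le> 3 * (norm v)\<^sup>2"
    "\<And>x. \<Theta> y + \<gamma> / 2 * (norm (y - z k))\<^sup>2 \<le> \<Theta> x + \<gamma> / 2 * (norm (x - z k))\<^sup>2"
proof -
  have zk: "\<Theta> (z k) \<le> \<Theta> (z 1)" and "\<rho> 1 \<le> \<rho> k" "\<rho> k \<le> \<rho>max"
    using invariant[OF k] by auto
  then have \<gamma>\<rho>: "2 * Kb \<le> \<gamma> - \<rho> k" and \<gamma>_pos: "\<gamma> > 0"
    using \<gamma>(1) \<rho>1 Kb_pos by auto
  obtain y where y: "\<And>x. \<Theta> y + \<gamma> / 2 * (norm (y - z k))\<^sup>2 \<le> \<Theta> x + \<gamma> / 2 * (norm (x - z k))\<^sup>2"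
    using proximal_minimizer_exists[OF \<Theta>_continuous \<Theta>_level_bounded] \<gamma>_pos by (metis less_imp_le)
  define w where "w = y - z k"
  have yz: "\<Theta> y + \<gamma> / 2 * (norm w)\<^sup>2 \<le> \<Theta> (z k)"
    using y[of "z k"] by (simp add: w_def)
  have "\<gamma> * (norm w)\<^sup>2 \<le> 2 * (\<Theta> (z 1) - \<Theta>min)"
    using yz zk \<Theta>min_le[of y] by simp
  then have "\<gamma> * (norm w)\<^sup>2 \<le> \<gamma> * r\<^sup>2" "\<gamma> * (norm w)\<^sup>2 \<le> \<gamma> * \<delta>\<^sup>2"
    using \<gamma> by linarith+
  then have w: "norm w \<le> r" "norm w \<le> \<delta>"
    using \<gamma>_pos r_pos \<delta> by (auto simp: power2_le_iff_abs_le)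
  have "\<Phi> k v \<le> \<Phi> k w"
    using step_minimizes_model[OF k w(2)] v by simp
  moreover have "\<Theta> (z k + w) + \<gamma> / 2 * (norm w)\<^sup>2 \<le> \<Theta> (z k + v) + \<gamma> / 2 * (norm v)\<^sup>2"
    using y[of "z k + v"] by (simp add: w_def)
  \<comment> \<open>Both values of \<open>\<Theta>\<close> are replaced by model values, at a cost
    of \<open>Kb / 2\<close> times the squared length each; the non-quadratic parts are compared by
    \<open>\<Phi> k v \<le> \<Phi> k w\<close>.\<close>
  ultimately have "\<gamma> / 2 * (norm w)\<^sup>2 - \<rho> k / 2 * (norm w)\<^sup>2 - Kb / 2 * (norm w)\<^sup>2
      \<le> \<gamma> / 2 * (norm v)\<^sup>2 - \<rho> k / 2 * (norm v)\<^sup>2 + Kb / 2 * (norm v)\<^sup>2"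
    using model_approximates[OF zk w(1), of "\<rho> k"] model_approximates[OF zk v(2), of "\<rho> k"] by linarith
  then have "(\<gamma> - \<rho> k - Kb) * (norm w)\<^sup>2 \<le> (\<gamma> - \<rho> k + Kb) * (norm v)\<^sup>2"
    by (simp add: algebra_simps)
  also have "\<dots> \<le> ((\<gamma> - \<rho> k - Kb) * 3) * (norm v)\<^sup>2"
    using \<gamma>\<rho> by (intro mult_right_mono) auto
  finally have "(norm w)\<^sup>2 \<le> 3 * (norm v)\<^sup>2"
    unfolding mult.assoc by (rule mult_left_le_imp_le) (use \<gamma>\<rho> Kb_pos in linarith)
  moreover have "\<Theta> y \<le> \<Theta> (z 1)"
  proof -
    have "0 \<le> \<gamma> / 2 * (norm w)\<^sup>2" using \<gamma>_pos by simp
    with yz zk show ?thesis by linarith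
  qed
  ultimately show ?thesis
    using that y by (simp add: w_def)
qed

text \<open>If the run stops, the zero vector plays the role of a short step.\<close>

lemma short_step_exists:
  fixes N p :: nat
  assumes N: "(real N - real p) * (\<eta>1 * \<rho> 1 / 2 * q) > \<Theta> (z 1) - \<Theta>min" and "q \<ge> 0"
    and p: "Kb / (1 - \<eta>1) \<le> \<rho> 1 * \<eta>2 ^ p"
  obtains k v where "1 \<le> k" "k \<le> N" "enat k \<le> T" "\<Phi> k v = \<Phi> k (s k)" "norm v \<le> r" "(norm v)\<^sup>2 \<le> q"
proof (cases "T \<le> enat N")
  case True
  then obtain k where k: "T = enat k" "k \<le> N"
    by (cases T) auto
  then have "1 \<le> k" "enat k \<le> T"
    using T_ge_1 by auto
  moreover from this have "\<Phi> k 0 = \<Phi> k (s k)"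
    using iteration(2)[of k] k by simp
  ultimately show ?thesis
    using that[of k 0] k r_pos \<open>q \<ge> 0\<close> by simp
next
  case False
  have T: "enat k < T" if "k \<le> N" for k
    using that False by (meson enat_ord_simps(1) le_less_trans not_le)
  \<comment> \<open>If all \<open>N\<close> steps were long, the guaranteed decrease would push
    \<open>\<Theta>\<close> below \<open>\<Theta>min\<close>.\<close>
  have "\<exists>k\<in>{1..N}. (norm (s k))\<^sup>2 < q"
  proof (rule ccontr)
    assume "\<not> ?thesis"
    then have "(norm (s k))\<^sup>2 \<ge> q" if "k \<in> {1..N}" for k
      using that by (meson not_le)
    then have "\<Theta> (z (N + 1)) \<le> \<Theta> (z 1) - (real N - real p) * (\<eta>1 * \<rho> 1 / 2 * q)"
      using progress invariant T \<rho>1 \<eta>1 \<eta>2 p \<open>q \<ge> 0\<close>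
      by (intro descent_with_few_rejections[where a = "\<lambda>k. \<Theta> (z k)" and b = "\<lambda>k. (norm (s k))\<^sup>2"
            and C = "Kb / (1 - \<eta>1)" and \<rho> = \<rho>]) (auto simp: less_imp_le)
    then show False
      using N \<Theta>min_le[of "z (N + 1)"] by linarith
  qed
  then obtain k where k: "1 \<le> k" "k \<le> N" "(norm (s k))\<^sup>2 \<le> q"
    by auto
  have kT: "enat k \<le> T"
    using T[OF k(2)] by simp
  have "norm (s k) \<le> r"
    using invariant[OF k(1) kT] model_decreases[OF k(1) kT] by (intro step_norm_le[of "z k" "\<rho> k"]) auto
  with k kT show ?thesis
    using that[of k "s k"] by simp
qed

text \<open>Translates the constants of the statement into the numbers required by
  \<open>short_step_exists\<close> and \<open>proximal_point_near_iterate\<close>.\<close>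

lemma near_stationary:
  fixes \<epsilon> \<gamma> :: real
  assumes \<gamma>: "\<gamma> \<ge> 2 * (\<Theta> (z 1) - \<Theta>min) / r\<^sup>2" "\<gamma> \<ge> 8 * (\<Theta> (z 1) - \<Theta>min) / \<delta>\<^sup>2"
      "\<gamma> \<ge> \<rho> 1 * \<eta>2 + 2 * Kb" "\<gamma> \<ge> (\<eta>2\<^sup>2 / (1 - \<eta>1) + 2) * Kb" "\<gamma> \<ge> 1"
    and "\<epsilon> > 0"
    and \<kappa>1: "\<kappa>1 = max 0 \<lceil>log \<eta>2 (Kb / (\<rho> 1 * (1 - \<eta>1)))\<rceil> + 1"
    and kbar: "kbar = \<lceil>\<kappa>1 + 6 * \<gamma>\<^sup>2 / (\<eta>1 * \<rho> 1) * (\<Theta> (z 1) - \<Theta>min) / \<epsilon>\<^sup>2\<rceil>"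
  obtains k y where "1 \<le> k" "enat k \<le> T" "int k \<le> kbar" "\<Theta> y \<le> \<Theta> (z 1)"
    "\<gamma> * norm (y - z k) \<le> \<epsilon>"
    "\<And>x. \<Theta> y + \<gamma> / 2 * (norm (y - z k))\<^sup>2 \<le> \<Theta> x + \<gamma> / 2 * (norm (x - z k))\<^sup>2"
proof -
  define \<Delta> where "\<Delta> = \<Theta> (z 1) - \<Theta>min"
  define M where "M = 6 * \<gamma>\<^sup>2 / (\<eta>1 * \<rho> 1) * \<Delta> / \<epsilon>\<^sup>2"
  \<comment> \<open>After \<open>p\<close> rejections the parameter has reached the level at which
    every step is accepted.\<close>
  define p where "p = nat (max 0 \<lceil>log \<eta>2 (Kb / (\<rho> 1 * (1 - \<eta>1)))\<rceil>)"
  \<comment> \<open>Chosen so that \<open>3 * q\<close> times \<open>\<gamma>\<^sup>2\<close> equals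
    \<open>\<epsilon>\<^sup>2\<close>; the 3 is the factor from
    \<open>proximal_point_near_iterate\<close>.\<close>
  define q where "q = \<epsilon>\<^sup>2 / (3 * \<gamma>\<^sup>2)"
  have \<Delta>: "\<Delta> \<ge> 0"
    using \<Theta>min_le[of "z 1"] by (simp add: \<Delta>_def)
  have q: "q > 0"
    using \<open>\<epsilon> > 0\<close> \<gamma>(5) by (simp add: q_def)
  have M: "M \<ge> 0"
    using \<Delta> \<eta>1 \<rho>1 by (simp add: M_def)
  have "int p + 1 = \<kappa>1"
    by (simp add: \<kappa>1 p_def)
  then have "kbar = \<lceil>M + real_of_int (int p + 1)\<rceil>"
    unfolding kbar M_def \<Delta>_def by (simp only: add.commute)
  then have "kbar = int p + 1 + \<lceil>M\<rceil>"
    unfolding ceiling_add_of_int by simp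
  \<comment> \<open>Keeps \<open>kbar\<close> positive, so that passing to \<open>nat kbar\<close>
    loses nothing.\<close>
  moreover have "0 \<le> \<lceil>M\<rceil>"
    using M by simp
  ultimately have N: "int (nat kbar) = int p + 1 + \<lceil>M\<rceil>" "int (nat kbar) = kbar"
    by auto
  have "real_of_int (int (nat kbar)) \<ge> real p + 1 + M"
    unfolding N(1) by simp
  then have "M + 1 \<le> real (nat kbar) - real p"
    unfolding of_int_of_nat_eq by linarith
  then have "(M + 1) * (\<eta>1 * \<rho> 1 / 2 * q) \<le> (real (nat kbar) - real p) * (\<eta>1 * \<rho> 1 / 2 * q)"
    using q \<eta>1 \<rho>1 by (intro mult_right_mono) auto
  \<comment> \<open>\<open>M\<close> accepted long steps use up exactly the gap
    \<open>\<Delta>\<close>; the extra 1 in \<open>\<kappa>1\<close> makes the next inequality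
    strict.\<close>
  moreover have "M * (\<eta>1 * \<rho> 1 / 2 * q) = \<Delta>"
    using \<eta>1 \<rho>1 \<gamma>(5) \<open>\<epsilon> > 0\<close> by (simp add: M_def q_def)
  moreover have "\<eta>1 * \<rho> 1 / 2 * q > 0"
    using q \<eta>1 \<rho>1 by simp
  ultimately have many: "(real (nat kbar) - real p) * (\<eta>1 * \<rho> 1 / 2 * q) > \<Theta> (z 1) - \<Theta>min"
    unfolding \<Delta>_def[symmetric] by (simp add: distrib_right)
  have X: "Kb / (\<rho> 1 * (1 - \<eta>1)) > 0"
    using Kb_pos \<rho>1 \<eta>1 by simp
  have "log \<eta>2 (Kb / (\<rho> 1 * (1 - \<eta>1))) \<le> real p"
    unfolding p_def by linarith
  then have "Kb / (\<rho> 1 * (1 - \<eta>1)) \<le> \<eta>2 powr real p"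
    using X \<eta>2 by (simp add: log_le_iff)
  then have "Kb / (1 - \<eta>1) \<le> \<rho> 1 * \<eta>2 ^ p"
    using \<rho>1 \<eta>1 \<eta>2 by (simp add: powr_realpow field_simps)
  then obtain k v where k: "1 \<le> k" "k \<le> nat kbar" "enat k \<le> T"
    and v: "\<Phi> k v = \<Phi> k (s k)" "norm v \<le> r" "(norm v)\<^sup>2 \<le> q"
    using short_step_exists[OF many less_imp_le[OF q]] by metis
  \<comment> \<open>The third bound on \<open>\<gamma>\<close> handles the case
    \<open>\<rho> 1\<close> of the maximum, the fourth the other one.\<close>
  have "\<gamma> \<ge> \<rho>max + 2 * Kb"
  proof -
    have "\<eta>2 * (Kb / (1 - \<eta>1)) * 1 \<le> \<eta>2 * (Kb / (1 - \<eta>1)) * \<eta>2"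
      using \<eta>1 \<eta>2 Kb_pos by (intro mult_left_mono) auto
    then have "\<eta>2 * (Kb / (1 - \<eta>1)) + 2 * Kb \<le> \<gamma>"
      using \<gamma>(4) by (simp add: algebra_simps power2_eq_square)
    moreover have "\<rho> 1 * 1 \<le> \<rho> 1 * \<eta>2"
      using \<rho>1 \<eta>2 by (intro mult_left_mono) auto
    ultimately show ?thesis
      using \<gamma>(3) unfolding \<rho>max_def by linarith
  qed
  moreover have "2 * (\<Theta> (z 1) - \<Theta>min) \<le> \<gamma> * r\<^sup>2"
    using \<gamma>(1) r_pos by (simp add: divide_le_eq)
  moreover have "2 * (\<Theta> (z 1) - \<Theta>min) \<le> \<gamma> * \<delta>\<^sup>2"
    using \<gamma>(2) \<delta> \<Delta> unfolding \<Delta>_def by (simp add: divide_le_eq)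
  ultimately obtain y where y: "\<Theta> y \<le> \<Theta> (z 1)" "(norm (y - z k))\<^sup>2 \<le> 3 * (norm v)\<^sup>2"
    "\<And>x. \<Theta> y + \<gamma> / 2 * (norm (y - z k))\<^sup>2 \<le> \<Theta> x + \<gamma> / 2 * (norm (x - z k))\<^sup>2"
    using proximal_point_near_iterate[OF k(1,3) v(1,2)] by metis
  have "(norm (y - z k))\<^sup>2 \<le> 3 * q"
    using y(2) v(3) by linarith
  then have "(\<gamma> * norm (y - z k))\<^sup>2 \<le> \<epsilon>\<^sup>2"
    using \<gamma>(5) by (simp add: q_def field_simps power_mult_distrib)
  then have "\<gamma> * norm (y - z k) \<le> \<epsilon>"
    by (rule power2_le_imp_le) (use \<open>\<epsilon> > 0\<close> in simp)
  moreover have "int k \<le> kbar"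
    using k(2) N(2) by linarith
  ultimately show ?thesis
    using that k y by blast
qed

end

section \<open>Second-order stationarity from penalization\<close>

lemma bounded_linear_block: "bounded_linear (block blk l)"
  unfolding linear_conv_bounded_linear[symmetric]
  by (intro linearI) (auto simp: block_def vec_eq_iff)

lemma bounded_linear_upto_block: "bounded_linear (upto_block blk l)"
  unfolding linear_conv_bounded_linear[symmetric]
  by (intro linearI) (auto simp: upto_block_def vec_eq_iff)

lemmas block_linear = linear_add[OF bounded_linear.linear[OF bounded_linear_block]]
  linear_diff[OF bounded_linear.linear[OF bounded_linear_block]]
  linear_cmul[OF bounded_linear.linear[OF bounded_linear_block]]

lemmas upto_block_linear = linear_add[OF bounded_linear.linear[OF bounded_linear_upto_block]]
  linear_diff[OF bounded_linear.linear[OF bounded_linear_upto_block]]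
  linear_cmul[OF bounded_linear.linear[OF bounded_linear_upto_block]]

lemma upto_block_0 [simp]: "upto_block blk 0 u = 0"
  by (simp add: upto_block_def vec_eq_iff)

lemma upto_block_Suc: "upto_block blk (Suc l) u = upto_block blk l u + block blk (Suc l) u"
  by (auto simp: upto_block_def block_def vec_eq_iff le_Suc_eq)

lemma upto_block_all: "range blk \<subseteq> {1..L} \<Longrightarrow> upto_block blk L u = u"
  by (auto simp: upto_block_def vec_eq_iff subset_iff)

lemma l1_norm_nonneg: "l1_norm x \<ge> 0"
  unfolding l1_norm_def by (intro sum_nonneg) auto

lemma norm_le_l1_norm: "norm x \<le> l1_norm x"
  unfolding l1_norm_def by (rule norm_le_l1_cart)

text \<open>Layer \<open>l\<close> of the right-hand side depends only on earlier layers, so a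
  solution is built layer by layer.\<close>

lemma layer_recursion_solvable:
  fixes D :: "nat \<Rightarrow> real^'m \<Rightarrow> real^'m"
  assumes cong: "\<And>l u v. l \<in> {1..L} \<Longrightarrow> upto_block blk (l - 1) u = upto_block blk (l - 1) v \<Longrightarrow> D l u = D l v"
    and D_block: "\<And>l u. l \<in> {1..L} \<Longrightarrow> block blk l (D l u) = D l u"
  obtains w where "\<And>l. l \<in> {1..L} \<Longrightarrow> block blk l w = D l w"
proof -
  have "\<exists>w. \<forall>l\<in>{1..n}. block blk l w = D l w" if "n \<le> L" for n
    using that
  proof (induction n)
    case (Suc n)
    then obtain w where w: "\<And>l. l \<in> {1..n} \<Longrightarrow> block blk l w = D l w"
      by (meson Suc_leD)
    define w' where "w' = upto_block blk n w + D (Suc n) w"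
    have off: "D (Suc n) w $ i = 0" if "blk i \<noteq> Suc n" for i
    proof -
      have "D (Suc n) w $ i = block blk (Suc n) (D (Suc n) w) $ i"
        using D_block[of "Suc n" w] Suc.prems by simp
      with that show ?thesis by (simp add: block_def)
    qed
    \<comment> \<open>The appended vector lives in layer \<open>Suc n\<close> only, so the equations
      already solved are undisturbed.\<close>
    have upto: "upto_block blk (l - 1) w' = upto_block blk (l - 1) w" if "l \<le> Suc n" for l
      using that off by (auto simp: w'_def upto_block_def vec_eq_iff)
    have "block blk l w' = D l w'" if l: "l \<in> {1..Suc n}" for l
    proof -
      have D: "D l w' = D l w"
        using l Suc.prems upto[of l] by (intro cong) auto
      show ?thesis
      proof (cases "l = Suc n")
        case True
        have "block blk (Suc n) w' = block blk (Suc n) (D (Suc n) w)"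
          by (auto simp: w'_def block_def upto_block_def vec_eq_iff)
        then show ?thesis
          using True D D_block[of "Suc n" w] Suc.prems by simp
      next
        case False
        have "block blk l w' = block blk l w"
          using l False off by (auto simp: w'_def block_def upto_block_def vec_eq_iff)
        then show ?thesis
          using w[of l] l False D by simp
      qed
    qed
    then show ?case by blast
  qed auto
  then show ?thesis
    using that by blast
qed

text \<open>A discrete Gronwall inequality: each new layer multiplies the accumulated bound by
  \<open>1 + K n\<close>. This produces the products in the lower bounds for \<beta>.\<close>

lemma layer_growth:
  fixes x :: "real^'m::finite"
  assumes "\<And>l. l \<in> {1..n} \<Longrightarrow> norm (block blk l x) \<le> K (l - 1) * norm (upto_block blk (l - 1) x) + a l"
    and "\<And>l. l \<in> {1..<n} \<Longrightarrow> K l \<ge> 0"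
  shows "norm (upto_block blk n x) \<le> (\<Sum>l=1..n. (\<Prod>j=l+1..n. 1 + K (j - 1)) * a l)"
  using assms
proof (induction n)
  case (Suc n)
  define S where "S = (\<Sum>l=1..n. (\<Prod>j=l+1..n. 1 + K (j - 1)) * a l)"
  have IH: "norm (upto_block blk n x) \<le> S"
    unfolding S_def using Suc.prems by (intro Suc.IH) auto
  have "norm (upto_block blk (Suc n) x) \<le> norm (upto_block blk n x) + norm (block blk (Suc n) x)"
    unfolding upto_block_Suc by (rule norm_triangle_ineq)
  also have "\<dots> \<le> (1 + K n) * norm (upto_block blk n x) + a (Suc n)"
    using Suc.prems(1)[of "Suc n"] by (simp add: algebra_simps)
  also have "(1 + K n) * norm (upto_block blk n x) \<le> (1 + K n) * S"
  \<comment> \<open>\<open>K 0\<close> carries no sign condition, but for \<open>n = 0\<close> both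
    sides vanish.\<close>
  proof (cases "n = 0")
    case False
    then have "K n \<ge> 0" using Suc.prems(2)[of n] by simp
    then show ?thesis using IH by (intro mult_left_mono) auto
  qed (simp add: S_def)
  also have "(1 + K n) * S = (\<Sum>l=1..n. (\<Prod>j=l+1..Suc n. 1 + K (j - 1)) * a l)"
    unfolding S_def sum_distrib_left by (intro sum.cong) auto
  finally show ?case by simp
qed simp

section \<open>First-order analysis of the penalized objective at a point\<close>

lemma has_dir_deriv_norm_fst_sq:
  fixes x d :: "'a::real_inner \<times> 'b::real_inner"
  shows "has_dir_deriv (\<lambda>x. (norm (fst x))\<^sup>2) x d (2 * (fst x \<bullet> fst d))"
proof -
  have "((\<lambda>t. 2 * (fst x \<bullet> fst d) + t * (norm (fst d))\<^sup>2) \<longlongrightarrow> 2 * (fst x \<bullet> fst d) + 0 * (norm (fst d))\<^sup>2) (at_right 0)"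
    by (intro tendsto_intros)
  moreover have "\<forall>\<^sub>F t in at_right 0. 2 * (fst x \<bullet> fst d) + t * (norm (fst d))\<^sup>2
      = ((norm (fst (x + t *\<^sub>R d)))\<^sup>2 - (norm (fst x))\<^sup>2) /\<^sub>R t"
    using eventually_at_right_less[of "0::real"]
  proof eventually_elim
    case (elim t)
    then show ?case
      using dot_norm[of "fst x" "t *\<^sub>R fst d"]
      by (simp add: power_mult_distrib field_simps power2_eq_square)
  qed
  ultimately show ?thesis
    unfolding has_dir_deriv_def by (auto intro: Lim_transform_eventually)
qed

text \<open>The Lipschitz conditions are stated only at a fixed \<open>y\<close>, which will be a
  proximal point in the level set of the initial value.\<close>

locale penalized_net =
  fixes L :: nat and blk :: "'m::finite \<Rightarrow> nat" and g :: "real^'m \<Rightarrow> real"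
    and \<psi> :: "nat \<Rightarrow> (real^'n) \<times> (real^'m) \<Rightarrow> real^'m" and lam :: real and \<beta> :: "nat \<Rightarrow> real"
    and Kg :: real and K :: "nat \<Rightarrow> real" and y :: "(real^'n) \<times> (real^'m)"
  assumes blk: "range blk = {1..L}"
    and g: "twice_dir_differentiable g" "convex_on UNIV g"
    and layer: "l \<in> {1..L} \<Longrightarrow> layer_map blk l (\<psi> (l - 1))"
    and \<psi>: "l \<in> {1..L} \<Longrightarrow> twice_dir_differentiable (\<psi> (l - 1))"
    and lam: "lam > 0" and \<beta>_pos: "l \<in> {1..L} \<Longrightarrow> \<beta> l > 0"
    and Kg: "Kg > 0" "\<bar>dir_deriv g (snd y) v - dir_deriv g (snd y) v'\<bar> \<le> Kg * norm (v - v')"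
    and K: "l \<in> {1..L - 1} \<Longrightarrow> K l > 0"
      "fst d = fst d' \<Longrightarrow> l \<in> {2..L} \<Longrightarrow>
           norm (dir_deriv (\<psi> (l - 1)) (fst y, upto_block blk (l - 1) (snd y))
                   (fst d, upto_block blk (l - 1) (snd d))
               - dir_deriv (\<psi> (l - 1)) (fst y, upto_block blk (l - 1) (snd y))
                   (fst d', upto_block blk (l - 1) (snd d')))
             \<le> K (l - 1) * norm (upto_block blk (l - 1) (snd d) - upto_block blk (l - 1) (snd d'))"
    and \<beta>: "l \<in> {1..L} \<Longrightarrow> \<beta> l > (Kg + 1) * (\<Prod>j=l+1..L. 1 + K (j - 1))"
begin

abbreviation \<Theta> where "\<Theta> \<equiv> penalized blk L \<beta> \<psi> g lam"

text \<open>The truncation in \<open>penalized\<close> is dropped, which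
  \<open>\<psi>_upto_block\<close> justifies; this makes the rules for directional derivatives
  directly applicable.\<close>

definition residual :: "nat \<Rightarrow> (real^'n) \<times> (real^'m) \<Rightarrow> real^'m" where
  "residual l x = block blk l (snd x) - \<psi> (l - 1) x"

definition D\<psi> :: "nat \<Rightarrow> (real^'n) \<times> (real^'m) \<Rightarrow> real^'m" where
  "D\<psi> l d = dir_deriv (\<psi> (l - 1)) y d"

text \<open>The directional derivative of \<open>objective g lam\<close> at
  \<open>y\<close>.\<close>

definition DF :: "(real^'n) \<times> (real^'m) \<Rightarrow> real" where
  "DF d = dir_deriv g (snd y) (snd d) + lam * (2 * (fst y \<bullet> fst d))"

lemma \<psi>_upto_block:
  assumes "l \<in> {1..L}"
  shows "\<psi> (l - 1) (\<theta>, upto_block blk (l - 1) u) = \<psi> (l - 1) (\<theta>, u)"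
  using layer[OF assms] unfolding layer_map_def by metis

lemma \<Theta>_residual:
  "\<Theta> x = g (snd x) + lam * (norm (fst x))\<^sup>2 + (\<Sum>l=1..L. \<beta> l * (\<Sum>i\<in>UNIV. \<bar>residual l x $ i\<bar>))"
proof -
  have "\<beta> l * l1_norm (block blk l (snd x) - \<psi> (l - 1) (fst x, upto_block blk (l - 1) (snd x)))
      = \<beta> l * (\<Sum>i\<in>UNIV. \<bar>residual l x $ i\<bar>)" if "l \<in> {1..L}" for l
    using \<psi>_upto_block[OF that, of "fst x" "snd x"] by (simp add: l1_norm_def residual_def)
  then show ?thesis
    unfolding penalized_def objective_def by (intro arg_cong2[where f = "(+)"] refl sum.cong)
qed

lemma has_dir_deriv_\<psi>: "l \<in> {1..L} \<Longrightarrow> has_dir_deriv (\<psi> (l - 1)) y d (D\<psi> l d)"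
  unfolding D\<psi>_def by (intro twice_dir_differentiableD \<psi>)

text \<open>Truncation is linear and leaves the values of \<open>\<psi>\<close> unchanged, so the
  two difference quotients coincide for every \<open>t\<close>.\<close>

lemma D\<psi>_upto_block:
  assumes l: "l \<in> {1..L}"
  shows "dir_deriv (\<psi> (l - 1)) (fst y, upto_block blk (l - 1) (snd y))
      (fst d, upto_block blk (l - 1) (snd d)) = D\<psi> l d"
proof -
  have "\<psi> (l - 1) ((fst y, upto_block blk (l - 1) (snd y)) + t *\<^sub>R (fst d, upto_block blk (l - 1) (snd d)))
      = \<psi> (l - 1) (y + t *\<^sub>R d)" for t
    using \<psi>_upto_block[OF l, of "fst y + t *\<^sub>R fst d" "snd y + t *\<^sub>R snd d"]
    by (simp add: upto_block_linear prod_eq_iff plus_prod_def scaleR_prod_def)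
  moreover have "\<psi> (l - 1) (fst y, upto_block blk (l - 1) (snd y)) = \<psi> (l - 1) y"
    using \<psi>_upto_block[OF l, of "fst y" "snd y"] by simp
  ultimately show ?thesis
    unfolding D\<psi>_def dir_deriv_def by simp
qed

lemma D\<psi>_cong:
  assumes "l \<in> {1..L}" "fst d = fst d'" "upto_block blk (l - 1) (snd d) = upto_block blk (l - 1) (snd d')"
  shows "D\<psi> l d = D\<psi> l d'"
  using D\<psi>_upto_block[OF assms(1), of d] D\<psi>_upto_block[OF assms(1), of d'] assms(2,3) by simp

lemma D\<psi>_lipschitz:
  assumes l: "l \<in> {1..L}" and d: "fst d = fst d'"
  shows "norm (D\<psi> l d - D\<psi> l d') \<le> K (l - 1) * norm (upto_block blk (l - 1) (snd d - snd d'))"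
\<comment> \<open>The first layer has no predecessors: its derivative depends on the
  \<open>\<theta>\<close>-part alone, and both sides vanish.\<close>
proof (cases "l = 1")
  case True
  then show ?thesis
    using D\<psi>_cong[OF l d] by simp
next
  case False
  then show ?thesis
    using K(2)[OF d, of l] l by (simp only: D\<psi>_upto_block[OF l] upto_block_linear) simp
qed

lemma block_D\<psi>:
  assumes l: "l \<in> {1..L}"
  shows "block blk l (D\<psi> l d) = D\<psi> l d"
proof (rule tendsto_unique)
  interpret bounded_linear "block blk l" by (rule bounded_linear_block)
  have "block blk l (\<psi> (l - 1) x) = \<psi> (l - 1) x" for x
    using layer[OF l] unfolding layer_map_def by blast
  then show "((\<lambda>t. (\<psi> (l - 1) (y + t *\<^sub>R d) - \<psi> (l - 1) y) /\<^sub>R t) \<longlongrightarrow> block blk l (D\<psi> l d)) (at_right 0)"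
    using tendsto[OF has_dir_deriv_\<psi>[OF l, of d, unfolded has_dir_deriv_def]] by (simp add: diff scaleR)
  show "((\<lambda>t. (\<psi> (l - 1) (y + t *\<^sub>R d) - \<psi> (l - 1) y) /\<^sub>R t) \<longlongrightarrow> D\<psi> l d) (at_right 0)"
    using has_dir_deriv_\<psi>[OF l, of d] unfolding has_dir_deriv_def .
qed simp

lemma block_residual:
  assumes "l \<in> {1..L}"
  shows "block blk l (residual l x) = residual l x"
proof -
  have "block blk l (\<psi> (l - 1) x) = \<psi> (l - 1) x"
    using layer[OF assms] unfolding layer_map_def by blast
  moreover have "block blk l (block blk l (snd x)) = block blk l (snd x)"
    by (simp add: block_def vec_eq_iff)
  ultimately show ?thesis
    unfolding residual_def block_linear by simp
qed

lemma has_dir_deriv_g: "has_dir_deriv (\<lambda>x. g (snd x)) y d (dir_deriv g (snd y) (snd d))"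
  using twice_dir_differentiableD[OF g(1), of "snd y" "snd d"] unfolding has_dir_deriv_def by simp

lemma has_dir_deriv_\<Theta>:
  "has_dir_deriv \<Theta> y d (DF d + (\<Sum>l=1..L. \<beta> l * (\<Sum>i\<in>UNIV.
     if residual l y $ i = 0 then \<bar>(block blk l (snd d) - D\<psi> l d) $ i\<bar>
     else sgn (residual l y $ i) * (block blk l (snd d) - D\<psi> l d) $ i)))"
proof -
  have "has_dir_deriv (\<lambda>x. residual l x) y d (block blk l (snd d) - D\<psi> l d)" if "l \<in> {1..L}" for l
    unfolding residual_def
    using has_dir_deriv_bounded_linear[OF bounded_linear_compose[OF bounded_linear_block bounded_linear_snd]]
    by (intro has_dir_deriv_diff has_dir_deriv_\<psi> that)
  then show ?thesis
    unfolding \<Theta>_residual[abs_def] DF_def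
    by (intro has_dir_deriv_add has_dir_deriv_sum has_dir_deriv_mult_const has_dir_deriv_abs
        has_dir_deriv_vec_nth has_dir_deriv_g has_dir_deriv_norm_fst_sq)
qed

text \<open>The shift \<open>v\<close> prescribes the rate at which the residuals decrease: the
  residuals themselves for restoring feasibility, zero for staying feasible to first order.\<close>

lemma solve_linearized_layers:
  assumes v: "\<And>l. l \<in> {1..L} \<Longrightarrow> block blk l (v l) = v l"
  obtains w where "\<And>l. l \<in> {1..L} \<Longrightarrow> block blk l w = D\<psi> l (\<theta>, w) - v l"
proof (rule layer_recursion_solvable[of L blk "\<lambda>l w. D\<psi> l (\<theta>, w) - v l"])
  show "D\<psi> l (\<theta>, u) - v l = D\<psi> l (\<theta>, u') - v l"
    if "l \<in> {1..L}" "upto_block blk (l - 1) u = upto_block blk (l - 1) u'" for l u u'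
    using D\<psi>_cong[OF that(1), of "(\<theta>, u)" "(\<theta>, u')"] that(2) by simp
  show "block blk l (D\<psi> l (\<theta>, u) - v l) = D\<psi> l (\<theta>, u) - v l" if "l \<in> {1..L}" for l u
    using block_D\<psi>[OF that] v[OF that] by (simp add: block_linear)
qed (rule that)

text \<open>
  The errors \<open>a l\<close> of the layers add up to an \<open>x\<close> with \<open>norm x \<le> (\<Sum>l=1..L. p l * l1_norm (a l))\<close>, where
  \<open>p l\<close> is the product in the lower bound for \<open>\<beta> l\<close>, so that the two hypotheses conflict unless all errors are zero.
\<close>

lemma residuals_vanish:
  assumes "\<And>l. l \<in> {1..L} \<Longrightarrow> norm (block blk l x) \<le> K (l - 1) * norm (upto_block blk (l - 1) x) + l1_norm (a l)"
    and "(\<Sum>l=1..L. \<beta> l * l1_norm (a l)) \<le> (Kg + 1) * norm x" and l: "l \<in> {1..L}"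
  shows "a l = 0"
proof -
  define p where "p l = (\<Prod>j=l+1..L. 1 + K (j - 1))" for l
  have "norm (upto_block blk L x) \<le> (\<Sum>l=1..L. p l * l1_norm (a l))"
    unfolding p_def using assms(1) K(1) by (intro layer_growth) (auto simp: less_imp_le)
  then have "norm x \<le> (\<Sum>l=1..L. p l * l1_norm (a l))"
    using blk by (simp add: upto_block_all)
  then have "(Kg + 1) * norm x \<le> (Kg + 1) * (\<Sum>l=1..L. p l * l1_norm (a l))"
    using Kg by (intro mult_left_mono) auto
  with assms(2) have "(\<Sum>l=1..L. (\<beta> l - (Kg + 1) * p l) * l1_norm (a l)) \<le> 0"
    by (simp add: left_diff_distrib sum_subtractf sum_distrib_left mult.assoc)
  moreover have pos: "\<beta> l - (Kg + 1) * p l > 0" if "l \<in> {1..L}" for l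
    using \<beta>[OF that] by (simp add: p_def)
  then have nonneg: "(\<beta> l - (Kg + 1) * p l) * l1_norm (a l) \<ge> 0" if "l \<in> {1..L}" for l
    using that l1_norm_nonneg by (intro mult_nonneg_nonneg) (auto simp: less_imp_le)
  ultimately have "(\<Sum>l=1..L. (\<beta> l - (Kg + 1) * p l) * l1_norm (a l)) = 0"
    by (intro antisym sum_nonneg) auto
  then have "(\<beta> l - (Kg + 1) * p l) * l1_norm (a l) = 0"
    using nonneg l by (subst (asm) sum_nonneg_eq_0_iff) auto
  then have "l1_norm (a l) = 0"
    using pos[OF l] by simp
  then show ?thesis
    using norm_le_l1_norm[of "a l"] by simp
qed

section \<open>Approximately stationary points and their critical directions\<close>

context
  fixes \<epsilon> :: real
  assumes \<epsilon>: "0 < \<epsilon>" "\<epsilon> < 1"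
    and stationary: "\<And>d. dir_deriv \<Theta> y d \<ge> - \<epsilon> * norm d"
begin

text \<open>
  The direction \<open>(0, w)\<close> solves the layers' linearized equations for removing the residuals.
\<close>

lemma stationary_feasible:
  assumes l: "l \<in> {1..L}"
  shows "residual l y = 0"
proof -
  obtain w where w: "\<And>l. l \<in> {1..L} \<Longrightarrow> block blk l w = D\<psi> l (0, w) - residual l y"
    using solve_linearized_layers[of "\<lambda>l. residual l y"] block_residual by blast
  have D0: "D\<psi> l 0 = 0" "dir_deriv g (snd y) 0 = 0" for l
    by (auto simp: D\<psi>_def intro!: dir_deriv_eq simp: has_dir_deriv_def)
  have "norm (block blk l w) \<le> K (l - 1) * norm (upto_block blk (l - 1) w) + l1_norm (residual l y)"
    if "l \<in> {1..L}" for l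
  proof -
    have "norm (block blk l w) \<le> norm (D\<psi> l (0, w)) + norm (residual l y)"
      unfolding w[OF that] by (rule norm_triangle_ineq4)
    moreover have "norm (D\<psi> l (0, w)) \<le> K (l - 1) * norm (upto_block blk (l - 1) w)"
      using D\<psi>_lipschitz[OF that, of "(0, w)" 0] by (simp add: D0)
    ultimately show ?thesis
      using norm_le_l1_norm[of "residual l y"] by linarith
  qed
  moreover have "(\<Sum>l=1..L. \<beta> l * l1_norm (residual l y)) \<le> (Kg + 1) * norm w"
  proof -
    \<comment> \<open>Along \<open>(0, w)\<close> each residual has derivative minus itself, so zero
      components stay at zero to first order and the others shrink.\<close>
    have "dir_deriv \<Theta> y (0, w) = DF (0, w) + (\<Sum>l=1..L. \<beta> l * (\<Sum>i\<in>UNIV. - \<bar>residual l y $ i\<bar>))"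
      using dir_deriv_eq[OF has_dir_deriv_\<Theta>[of "(0, w)"]] w
      by (auto simp: abs_sgn mult.commute intro!: sum.cong arg_cong2[where f = "(*)"])
    also have "\<dots> = dir_deriv g (snd y) w - (\<Sum>l=1..L. \<beta> l * l1_norm (residual l y))"
      by (simp add: DF_def l1_norm_def sum_negf)
    also have "dir_deriv g (snd y) w \<le> Kg * norm w"
      using Kg(2)[of w 0] by (simp add: D0)
    finally have "dir_deriv \<Theta> y (0, w) \<le> Kg * norm w - (\<Sum>l=1..L. \<beta> l * l1_norm (residual l y))"
      by simp
    \<comment> \<open>\<open>\<epsilon> < 1\<close> turns the stationarity error into the 1 in
      \<open>Kg + 1\<close>.\<close>
    moreover have "\<epsilon> * norm w \<le> 1 * norm w"
      using \<epsilon> by (intro mult_right_mono) auto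
    ultimately show ?thesis
      using stationary[of "(0, w)"] by (simp add: norm_Pair distrib_right)
  qed
  ultimately show ?thesis
    by (rule residuals_vanish[OF _ _ l])
qed

lemma dir_deriv_\<Theta>_stationary:
  "dir_deriv \<Theta> y d = DF d + (\<Sum>l=1..L. \<beta> l * l1_norm (block blk l (snd d) - D\<psi> l d))"
  unfolding dir_deriv_eq[OF has_dir_deriv_\<Theta>[of d]] l1_norm_def
  by (intro arg_cong2[where f = "(+)"] refl sum.cong) (simp add: stationary_feasible)

text \<open>
  A direction \<open>d\<close> with \<open>dir_deriv \<Theta> y d = - \<epsilon>\<close> is compared with the direction that has the same
  \<open>\<theta>\<close>-part and satisfies the linearized layer equations; it is longer by at most \<open>norm x\<close>, and
  \<open>\<epsilon> < 1\<close> makes this affordable.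
\<close>

lemma critical_direction_feasible:
  assumes d: "norm d = 1" "dir_deriv \<Theta> y d = - \<epsilon>" and l: "l \<in> {1..L}"
  shows "block blk l (snd d) - D\<psi> l d = 0"
proof -
  obtain w where w: "\<And>l. l \<in> {1..L} \<Longrightarrow> block blk l w = D\<psi> l (fst d, w)"
    using solve_linearized_layers[of "\<lambda>l. 0" "fst d"] block_linear(2)[of _ _ 0 0] by auto
  define x where "x = snd d - w"
  define a where "a l = block blk l (snd d) - D\<psi> l d" for l
  have "norm (block blk l x) \<le> K (l - 1) * norm (upto_block blk (l - 1) x) + l1_norm (a l)"
    if "l \<in> {1..L}" for l
  proof -
    have "block blk l x = (D\<psi> l d - D\<psi> l (fst d, w)) + a l"
      using w[OF that] by (simp add: x_def a_def block_linear)
    then have "norm (block blk l x) \<le> norm (D\<psi> l d - D\<psi> l (fst d, w)) + norm (a l)"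
      using norm_triangle_ineq by metis
    moreover have "norm (D\<psi> l d - D\<psi> l (fst d, w)) \<le> K (l - 1) * norm (upto_block blk (l - 1) x)"
      using D\<psi>_lipschitz[OF that, of d "(fst d, w)"] by (simp add: x_def)
    ultimately show ?thesis
      using norm_le_l1_norm[of "a l"] by linarith
  qed
  moreover have "(\<Sum>l=1..L. \<beta> l * l1_norm (a l)) \<le> (Kg + 1) * norm x"
  proof -
    have "dir_deriv \<Theta> y (fst d, w) = DF (fst d, w)"
      unfolding dir_deriv_\<Theta>_stationary using w by (simp add: l1_norm_def)
    also have "\<dots> \<le> DF d + Kg * norm x"
      using Kg(2)[of w "snd d"] by (simp add: DF_def x_def norm_minus_commute)
    finally have "- \<epsilon> * norm (fst d, w) \<le> DF d + Kg * norm x"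
      using stationary[of "(fst d, w)"] by linarith
    moreover have "norm (fst d, w) \<le> 1 + norm x"
    proof -
      have "(fst d, w) = d - (0, x)"
        by (simp add: x_def prod_eq_iff)
      then show ?thesis
        using norm_triangle_ineq4[of d "(0, x)"] d by (simp add: norm_Pair)
    qed
    then have "\<epsilon> * norm (fst d, w) \<le> \<epsilon> * (1 + norm x)"
      using \<epsilon> by (intro mult_left_mono) auto
    moreover have "\<epsilon> * norm x \<le> 1 * norm x"
      using \<epsilon> by (intro mult_right_mono) auto
    \<comment> \<open>Inserting this equality cancels the constant \<open>- \<epsilon>\<close>,
      leaving only terms proportional to \<open>norm x\<close>.\<close>
    moreover have "DF d + (\<Sum>l=1..L. \<beta> l * l1_norm (a l)) = - \<epsilon>"
      using d(2) unfolding dir_deriv_\<Theta>_stationary a_def .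
    ultimately show ?thesis
      by (simp add: distrib_right distrib_left)
  qed
  ultimately have "a l = 0"
    by (rule residuals_vanish[OF _ _ l])
  then show ?thesis
    by (simp add: a_def)
qed

text \<open>Each residual vanishes at \<open>y\<close> together with its derivative along
  \<open>d\<close>, so along the ray it is minus the second-order remainder of
  \<open>\<psi>\<close>. The limit \<open>q\<close> of the second-order quotients is thus explicit,
  with nonnegative summands.\<close>

lemma critical_direction_dir_deriv2_nonneg:
  assumes d: "norm d = 1" "dir_deriv \<Theta> y d = - \<epsilon>"
  shows "dir_deriv2 \<Theta> y d \<ge> 0"
proof -
  define G where "G t = (g (snd y + t *\<^sub>R snd d) - g (snd y) - t *\<^sub>R dir_deriv g (snd y) (snd d)) /\<^sub>R (t\<^sup>2 / 2)" for t
  define R where "R l t = (\<psi> (l - 1) (y + t *\<^sub>R d) - \<psi> (l - 1) y - t *\<^sub>R D\<psi> l d) /\<^sub>R (t\<^sup>2 / 2)" for l t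
  define Q where "Q t = G t + 2 * lam * (norm (fst d))\<^sup>2 + (\<Sum>l=1..L. \<beta> l * (\<Sum>i\<in>UNIV. \<bar>R l t $ i\<bar>))" for t
  define q where "q = dir_deriv2 g (snd y) (snd d) + 2 * lam * (norm (fst d))\<^sup>2
    + (\<Sum>l=1..L. \<beta> l * (\<Sum>i\<in>UNIV. \<bar>dir_deriv2 (\<psi> (l - 1)) y d $ i\<bar>))"
  have "(Q \<longlongrightarrow> q) (at_right 0)"
    unfolding Q_def q_def G_def R_def D\<psi>_def
    by (intro tendsto_intros dir_deriv2_tendsto g \<psi>)
  moreover have "\<forall>\<^sub>F t in at_right 0. Q t = (\<Theta> (y + t *\<^sub>R d) - \<Theta> y - t *\<^sub>R dir_deriv \<Theta> y d) /\<^sub>R (t\<^sup>2 / 2)"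
    using eventually_at_right_less[of "0::real"]
  proof eventually_elim
    case (elim t)
    have "\<bar>residual l (y + t *\<^sub>R d) $ i\<bar> = t\<^sup>2 / 2 * \<bar>R l t $ i\<bar>" if "l \<in> {1..L}" for l i
    proof -
      have "residual l (y + t *\<^sub>R d) = - ((t\<^sup>2 / 2) *\<^sub>R R l t)"
        using stationary_feasible[OF that] critical_direction_feasible[OF d that] elim
        by (simp add: R_def residual_def block_linear)
      then show ?thesis
        by (simp add: abs_mult)
    qed
    then have "\<Theta> (y + t *\<^sub>R d) = g (snd y + t *\<^sub>R snd d) + lam * (norm (fst y + t *\<^sub>R fst d))\<^sup>2
        + t\<^sup>2 / 2 * (\<Sum>l=1..L. \<beta> l * (\<Sum>i\<in>UNIV. \<bar>R l t $ i\<bar>))"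
      unfolding \<Theta>_residual sum_distrib_left
      by (intro arg_cong2[where f = "(+)"] sum.cong) simp_all
    moreover have "\<Theta> y = g (snd y) + lam * (norm (fst y))\<^sup>2"
      unfolding \<Theta>_residual using stationary_feasible by simp
    moreover have "dir_deriv \<Theta> y d = DF d"
      unfolding dir_deriv_\<Theta>_stationary using critical_direction_feasible[OF d] by (simp add: l1_norm_def)
    moreover have "(norm (fst y + t *\<^sub>R fst d))\<^sup>2 = (norm (fst y))\<^sup>2 + 2 * t * (fst y \<bullet> fst d) + t\<^sup>2 * (norm (fst d))\<^sup>2"
      using dot_norm[of "fst y" "t *\<^sub>R fst d"] by (simp add: power_mult_distrib)
    moreover have "g (snd y + t *\<^sub>R snd d) - g (snd y) - t * dir_deriv g (snd y) (snd d) = t\<^sup>2 / 2 * G t"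
      using elim by (simp add: G_def)
    ultimately have "\<Theta> (y + t *\<^sub>R d) - \<Theta> y - t *\<^sub>R dir_deriv \<Theta> y d = (t\<^sup>2 / 2) *\<^sub>R Q t"
      by (simp add: Q_def DF_def algebra_simps)
    then show ?case
      using elim by (simp only:) simp
  qed
  ultimately have "dir_deriv2 \<Theta> y d = q"
    unfolding dir_deriv2_def by (intro tendsto_Lim) (auto intro: Lim_transform_eventually)
  moreover have "dir_deriv2 g (snd y) (snd d) \<ge> 0"
  \<comment> \<open>Convexity places \<open>g\<close> above its first-order expansion along the
    ray.\<close>
  proof (rule tendsto_lowerbound[OF dir_deriv2_tendsto[OF g(1)]])
    show "\<forall>\<^sub>F t in at_right 0. 0 \<le> (g (snd y + t *\<^sub>R snd d) - g (snd y) - t *\<^sub>R dir_deriv g (snd y) (snd d)) /\<^sub>R (t\<^sup>2 / 2)"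
      using eventually_at_right_less[of "0::real"]
    proof eventually_elim
      case (elim t)
      then show ?case
        using convex_on_dir_deriv_le[OF g(2) twice_dir_differentiableD[OF g(1)], of t "snd y" "snd d"] by simp
    qed
  qed simp
  ultimately show ?thesis
    unfolding q_def using lam \<beta>_pos
    by (auto intro!: add_nonneg_nonneg sum_nonneg mult_nonneg_nonneg simp: less_imp_le)
qed

end

end

section \<open>The complexity bound\<close>

theorem corollary3p5:
  fixes L J m :: nat
    and blk :: "'m::finite \<Rightarrow> nat"
    and g :: "real^'m \<Rightarrow> real"
    and \<psi> :: "nat \<Rightarrow> (real^'n) \<times> (real^'m) \<Rightarrow> real^'m"
    and lam :: real and \<beta> :: "nat \<Rightarrow> real"
    and F \<Theta> H :: "(real^'n) \<times> (real^'m) \<Rightarrow> real"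
    and c :: "nat \<Rightarrow> (real^'n) \<times> (real^'m) \<Rightarrow> real"
    and P :: "nat \<Rightarrow> ((real^'n) \<times> (real^'m)) set"
    and \<Theta>min :: real
    and u0 :: "real^'m" and z0 :: "(real^'n) \<times> (real^'m)"
    and Kg :: real and K :: "nat \<Rightarrow> real"
    and \<eta>1 \<eta>2 \<delta> :: real
    and z s :: "nat \<Rightarrow> (real^'n) \<times> (real^'m)" and \<rho> :: "nat \<Rightarrow> real" and T :: enat
    and KF KbF Kbc r \<gamma> \<epsilon> :: real and \<kappa>1 kbar :: int
  assumes "L \<ge> 1" and "range blk = {1..L}"
    and "\<And>u. g u \<ge> 0" and "locally_lipschitz g" and "twice_dir_differentiable g"
    and "\<And>l. l \<in> {1..L} \<Longrightarrow> layer_map blk l (\<psi> (l - 1))"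
    and "\<And>l. l \<in> {1..L} \<Longrightarrow> locally_lipschitz (\<psi> (l - 1))"
    and "\<And>l. l \<in> {1..L} \<Longrightarrow> twice_dir_differentiable (\<psi> (l - 1))"
    and "lam > 0" and "\<And>l. l \<in> {1..L} \<Longrightarrow> \<beta> l > 0"
    and "F = objective g lam"
    and "\<Theta> = penalized blk L \<beta> \<psi> g lam"
    and "z0 = (0, u0)"
    and "\<And>l. l \<in> {1..L} \<Longrightarrow> block blk l u0 = \<psi> (l - 1) (0, upto_block blk (l - 1) u0)"
    and "smooth g"
    and "\<And>l i. l \<in> {1..L} \<Longrightarrow> blk i = l \<Longrightarrow>
           smooth (\<lambda>x. \<psi> (l - 1) x $ i) \<or> piecewise_affine (\<lambda>x. \<psi> (l - 1) x $ i)"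
    and "penalty_decomposition blk \<beta> \<psi> \<Theta> F H c J"
    and "\<And>i. i \<in> {1..m} \<Longrightarrow> polyhedron (P i) \<and> P i \<noteq> {} \<and> affine_fun_on (P i) H"
    and "inj_on P {1..m}" and "(\<Union>i\<in>{1..m}. P i) = UNIV"
    and "level_bounded \<Theta>"
    and "\<Theta>min \<in> range \<Theta>" and "\<And>x. \<Theta>min \<le> \<Theta> x"
    and "convex_on UNIV g"
    and "Kg > 0" and "\<And>l. l \<in> {1..L - 1} \<Longrightarrow> K l > 0"
    and "\<And>x (d :: (real^'n) \<times> (real^'m)) d'. x \<in> lev \<Theta> (\<Theta> z0) \<Longrightarrow> fst d = fst d' \<Longrightarrow>
           \<bar>dir_deriv g (snd x) (snd d) - dir_deriv g (snd x) (snd d')\<bar>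
             \<le> Kg * norm (snd d - snd d')"
    and "\<And>x d d' l. x \<in> lev \<Theta> (\<Theta> z0) \<Longrightarrow> fst d = fst d' \<Longrightarrow> l \<in> {2..L} \<Longrightarrow>
           norm (dir_deriv (\<psi> (l - 1)) (fst x, upto_block blk (l - 1) (snd x))
                   (fst d, upto_block blk (l - 1) (snd d))
               - dir_deriv (\<psi> (l - 1)) (fst x, upto_block blk (l - 1) (snd x))
                   (fst d', upto_block blk (l - 1) (snd d')))
             \<le> K (l - 1) * norm (upto_block blk (l - 1) (snd d) - upto_block blk (l - 1) (snd d'))"
    and "\<And>l. l \<in> {1..L} \<Longrightarrow> \<beta> l > (Kg + 1) * (\<Prod>j=l+1..L. 1 + K (j - 1))"
    and "z 1 \<in> lev \<Theta> (\<Theta> z0)"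
    and "\<rho> 1 > 0" and "0 < \<eta>1" and "\<eta>1 < 1" and "\<eta>2 > 1" and "\<delta> > 0"
    and "srpa_run \<Theta> F H c J m P \<eta>1 \<eta>2 \<delta> z \<rho> s T"
    and "r = 2 * KF / \<rho> 1 + sqrt (2 * \<Theta> (z 1) / \<rho> 1)"
    and "KF > 0" and "\<And>x. x \<in> lev \<Theta> (\<Theta> (z 1)) \<Longrightarrow> norm (gradient F x) \<le> KF"
    and "KbF > 0" and "Kbc > 0"
    and "\<And>x y. x \<in> {a + b | a b. a \<in> lev \<Theta> (\<Theta> (z 1)) \<and> b \<in> cball 0 r} \<Longrightarrow>
                y \<in> {a + b | a b. a \<in> lev \<Theta> (\<Theta> (z 1)) \<and> b \<in> cball 0 r} \<Longrightarrow>
           norm (gradient F x - gradient F y) \<le> KbF * norm (x - y) \<and>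
           spectral_norm J (\<lambda>j. gradient (c j) x - gradient (c j) y) \<le> Kbc * norm (x - y)"
    and "\<kappa>1 = max 0 \<lceil>log \<eta>2 ((KbF + sqrt J * Kbc) / (\<rho> 1 * (1 - \<eta>1)))\<rceil> + 1"
    and "\<gamma> = Max {2 * (\<Theta> (z 1) - \<Theta>min) / (sqrt (2 * \<Theta> (z 1) / \<rho> 1) + 2 * KF / \<rho> 1)\<^sup>2,
                  8 * (\<Theta> (z 1) - \<Theta>min) / \<delta>\<^sup>2,
                  \<rho> 1 * \<eta>2 + 2 * (KbF + sqrt J * Kbc),
                  (\<eta>2\<^sup>2 / (1 - \<eta>1) + 2) * (KbF + sqrt J * Kbc),
                  1}"
    and "0 < \<epsilon>" and "\<epsilon> < 1"
    and "kbar = \<lceil>\<kappa>1 + 6 * \<gamma>\<^sup>2 / (\<eta>1 * \<rho> 1) * (\<Theta> (z 1) - \<Theta>min) / \<epsilon>\<^sup>2\<rceil>"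
  shows "\<exists>k\<ge>1. enat k \<le> T \<and> int k \<le> kbar \<and> approx_second_order_d_stationary \<Theta> \<epsilon> (z k)"
proof -
  note blk = assms(2) and g_nonneg = assms(3) and g2 = assms(5) and lay = assms(6) and \<psi>2 = assms(8)
    and lam = assms(9) and \<beta>_pos = assms(10) and F = assms(11) and \<Theta> = assms(12)
    and smooth_g = assms(15) and decomp = assms(17) and cover = assms(20)
    and convex = assms(24) and Kg = assms(25) and K = assms(26) and lip_g = assms(27)
    and lip_\<psi> = assms(28) and \<beta> = assms(29) and z1 = assms(30)
  have \<Theta>_eq: "\<Theta> x = F x + H x + (\<Sum>j=1..J. \<bar>c j x\<bar>)" and H: "0 \<le> H x" "continuous_on UNIV H"
    and smooth_c: "j \<in> {1..J} \<Longrightarrow> smooth (c j)" for x j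
    using decomp unfolding penalty_decomposition_def by blast+
  have F_nonneg: "0 \<le> F x" for x
    using g_nonneg lam by (simp add: F objective_def)
  have F_diff: "F differentiable (at x)" for x
  proof -
    have "g differentiable (at (snd x))"
      using smooth_g by (simp add: smooth_def)
    moreover have "snd differentiable (at x)" "fst differentiable (at x)"
      by (auto intro: bounded_linear_imp_differentiable bounded_linear_snd bounded_linear_fst)
    ultimately show ?thesis
      unfolding F objective_def[abs_def] power2_norm_eq_inner
      by (intro differentiable_add differentiable_mult differentiable_const differentiable_inner)
        (auto intro: differentiable_compose)
  qed
  interpret srpa F H \<Theta> c J m P \<eta>1 \<eta>2 \<delta> z s \<rho> T KF KbF Kbc r \<Theta>min
    using F_diff smooth_c F_nonneg H \<Theta>_eq assms(21) assms(23) cover assms(31-42)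
    by unfold_locales (simp_all only: smooth_def)
  have \<gamma>: "\<gamma> \<ge> 2 * (\<Theta> (z 1) - \<Theta>min) / r\<^sup>2" "\<gamma> \<ge> 8 * (\<Theta> (z 1) - \<Theta>min) / \<delta>\<^sup>2"
      "\<gamma> \<ge> \<rho> 1 * \<eta>2 + 2 * Kb" "\<gamma> \<ge> (\<eta>2\<^sup>2 / (1 - \<eta>1) + 2) * Kb" "\<gamma> \<ge> 1"
    unfolding Kb_def r_eq assms(44) add.commute[of "2 * KF / \<rho> 1"] by (intro Max_ge; simp)+
  obtain k y where k: "1 \<le> k" "enat k \<le> T" "int k \<le> kbar" and y: "\<Theta> y \<le> \<Theta> (z 1)"
    "\<gamma> * norm (y - z k) \<le> \<epsilon>"
    "\<And>x. \<Theta> y + \<gamma> / 2 * (norm (y - z k))\<^sup>2 \<le> \<Theta> x + \<gamma> / 2 * (norm (x - z k))\<^sup>2"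
    using near_stationary[OF \<gamma> assms(45) assms(43)[folded Kb_def] assms(47)] by metis
  have y_lev: "y \<in> lev \<Theta> (\<Theta> z0)"
    using y(1) z1 by (simp add: lev_def)
  interpret net: penalized_net L blk g \<psi> lam \<beta> Kg K y
  proof
    \<comment> \<open>A direction in the \<open>u\<close>-variables is completed by a zero
      \<open>\<theta>\<close>-part.\<close>
    show "\<bar>dir_deriv g (snd y) v - dir_deriv g (snd y) v'\<bar> \<le> Kg * norm (v - v')" for v v'
      using lip_g[OF y_lev, of "(0, v)" "(0, v')"] by simp
  qed (use blk g2 convex lay \<psi>2 lam \<beta>_pos Kg K lip_\<psi>[OF y_lev] \<beta> in auto)
  have stationary: "dir_deriv \<Theta> y d \<ge> - \<epsilon> * norm d" for d
  proof -
    have "dir_deriv \<Theta> y d \<ge> - (\<gamma> * norm (y - z k) * norm d)"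
      using \<gamma>(5) net.has_dir_deriv_\<Theta>[of d] unfolding \<Theta>[symmetric]
      by (intro proximal_minimizer_dir_deriv[OF y(3)]) (auto simp: dir_deriv_eq)
    moreover have "\<gamma> * norm (y - z k) * norm d \<le> \<epsilon> * norm d"
      using y(2) by (intro mult_right_mono) auto
    ultimately show ?thesis by linarith
  qed
  \<comment> \<open>The entry 1 in the maximum defining \<open>\<gamma>\<close> turns
    \<open>\<gamma> * norm (y - z k) \<le> \<epsilon>\<close> into a distance bound.\<close>
  have "y \<in> cball (z k) \<epsilon>"
    using mult_right_mono[OF \<gamma>(5), of "norm (y - z k)"] y(2) by (simp add: dist_norm norm_minus_commute)
  moreover have "dir_deriv2 \<Theta> y d \<ge> - \<epsilon>" if "norm d = 1" "dir_deriv \<Theta> y d = - \<epsilon>" for d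
    using net.critical_direction_dir_deriv2_nonneg[OF assms(45,46) stationary[unfolded \<Theta>]] that assms(45)
    unfolding \<Theta> by fastforce
  moreover have "dir_deriv \<Theta> y d \<ge> - \<epsilon>" if "norm d = 1" for d
    using stationary[of d] that by simp
  ultimately have "approx_second_order_d_stationary \<Theta> \<epsilon> (z k)"
    unfolding approx_second_order_d_stationary_def by blast
  with k show ?thesis by blast
qed

end
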